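(* Let $E\subset Z$ be an $N$-dimensional affine subspace, $\mu_E=\mathcal{H}^N\llcorner E$, and $\mu=\mu_D\times\mu_E\in\mathcal{M}^+(Z\times Z)$ with $\mu_D\in\mathcal{M}^+(Z)$. Assume: (1) There is $\beta_0>0$ such that the family $(\mu_\beta)_{\beta\ge\beta_0}$ is uniformly bounded and uniformly tight in $\mathcal{M}_b(Z\times Z)$. For $h\in\mathbb{N}$ let $\mu_h=\mu_{D,h}\times\mu_E\in\mathcal{M}^+(Z\times Z)$ with $$\mu_{D,h}=\sum_{p\in P_h} m_p\,\delta_p ,$$ where $P_h\subset Z$ is an at most countable set of points and $m_p=m_p^h\ge 0$ are weights. Let $\beta_h\to+\infty$ and let $\epsilon_h>0$ with $\epsilon_h\to0$. Assume further that, for every $h$, there is a partition $\mathcal{A}_h=\{A_p:\ p\in P_h\}$ of $Z$ into Borel sets, with $p\in A_p$ and $\mu_D(A_p)<\infty$ for every $p\in P_h$, such that: (2) There is $\bar c>0$ such that, for all $h$ and all $p\in P_h$, $m_p\le\bar c\,\mu_D(A_p)$. (3) The sequence $(\beta_h\epsilon_h^2)$ is bounded. (4) There is $c_*\ge1$ such that for all $h\in\mathbb{N}$, $p\in P_h$, $z\in E$ and all $y\in A_p$, $$\|p-z\|^2\le c_*^2\big[\epsilon_h^2+\|y-z\|^2\big].$$ (5) For all $h\in\mathbb{N}$ and $p\in P_h$, $$\int_{A_p}\|y-p\|^2\,d\mu_D(y)\le\epsilon_h^2\,\mu_D(A_p).$$ Assume in addition that there is a sequence $\delta_h\ge 0$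 with $\delta_h\to0$ such that, for all $h$ and all $p\in P_h$, $$|m_p-\mu_D(A_p)|\le\delta_h\,\mu_D(A_p).$$ Then there is a constant $C>0$, independent of $h$, such that for all sufficiently large $h$ $$\|\mu_{h,\beta_h}-\mu_{\beta_h}\|_{\rm FN}\le C\,\big(\delta_h+\beta_h^{1/2}\epsilon_h\big)\,\sup_{\beta\ge\beta_0}\|\mu_\beta\|_{\rm TV}.$$
   Context: $Z$ is a finite-dimensional real space of dimension $2N$, equipped with a scalar product and the corresponding norm $\|\cdot\|$, and identified with $\mathbb{R}^{2N}$; $\mathcal{L}^{2N}$ is the Lebesgue measure on $Z$, $\mathcal{H}^N$ is the $N$-dimensional Hausdorff measure, and $\mathcal{H}^N\llcorner E$ is its restriction to $E$. $\delta_p$ is the Dirac mass at $p$. $\mathcal{M}^+(X)$ denotes the nonnegative Radon measures on $X$ ($X=Z$ or $Z\times Z$), $\mathcal{M}_b(X)$ the real-valued Radon measures of finite total variation, and $\|\nu\|_{\rm TV}:=|\nu|(X)$. Thermalization: for $\mu\in\mathcal{M}^+(Z\times Z)$ and $\beta>0$, $\mu_\beta:=w_\beta\,\mu$ with $w_\beta(y,z):=B_\beta^{-1}e^{-\beta\|y-z\|^2}$ and $B_\beta:=\int_Z e^{-\beta\|\xi\|^2}\,d\mathcal{L}^{2N}(\xi)$. Likewise $\mu_{h,\beta}:=w_\beta\,\mu_h$. A set $M\subseteq\mathcal{M}_b(Z\times Z)$ is uniformly bounded if there is $C>0$ with $|\nu|(Z\times Z)<C$ for all $\nu\in M$. It is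 uniformly tight if for every $\epsilon>0$ there is a compact set $K_\epsilon\subset Z\times Z$ with $|\nu|((Z\times Z)\setminus K_\epsilon)<\epsilon$ for all $\nu\in M$. Flat norm: for a fixed constant $\ell>0$ (depending only on the dimension), set $\|f\|_{\rm BL}:=\max\{\|f\|_\infty,\ \ell\,{\rm Lip}(f)\}$ for bounded Lipschitz functions $f$ on $Z\times Z$ (with the Euclidean product norm), and $\|\nu\|_{\rm FN}:=\sup\{\int_{Z\times Z} f\,d\nu:\ \|f\|_{\rm BL}\le 1\}$ for $\nu\in\mathcal{M}_b(Z\times Z)$. *)

theory Defs
  imports "HOL-Analysis.Analysis"
begin

section \<open>Hausdorff measure\<close>

text \<open>
  The size-\<open>d\<close> Hausdorff premeasure, with the usual normalisation making the \<open>n\<close>-dimensional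
  Hausdorff measure agree with Lebesgue measure on \<open>n\<close>-dimensional Euclidean space.  Covering sets
  must be bounded because the library's \<^const>\<open>diameter\<close> is meaningless on unbounded sets; the
  empty set contributes nothing, also for \<open>n = 0\<close> (where \<open>0 ^ 0 = 1\<close>).
\<close>

definition hausdorff_pre :: "nat \<Rightarrow> real \<Rightarrow> 'a::metric_space set \<Rightarrow> ennreal" where
  "hausdorff_pre n d A =
     (INF C \<in> {C :: nat \<Rightarrow> 'a set. A \<subseteq> (\<Union>i. C i) \<and> (\<forall>i. bounded (C i) \<and> diameter (C i) \<le> d)}.
        \<Sum>i. if C i = {} then 0 else ennreal (unit_ball_vol (real n) * (diameter (C i) / 2) ^ n))"

definition hausdorff_outer :: "nat \<Rightarrow> 'a::metric_space set \<Rightarrow> ennreal" where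
  "hausdorff_outer n A = (SUP d \<in> {0<..}. hausdorff_pre n d A)"

definition hausdorff_measure :: "nat \<Rightarrow> 'a::metric_space measure" where
  "hausdorff_measure n = measure_of UNIV (sets borel) (hausdorff_outer n)"

definition measure_restr :: "'a measure \<Rightarrow> 'a set \<Rightarrow> 'a measure" where
  "measure_restr M E = density M (indicator E)"


section \<open>Positive measures\<close>

text \<open>
  On the finite-dimensional spaces considered here every locally finite Borel measure is regular,
  and a nonnegative Radon measure is a Borel measure that is finite on compact sets.
\<close>

definition radon_measure :: "'a::topological_space measure \<Rightarrow> bool" where
  "radon_measure M \<longleftrightarrow> sets M = sets borel \<and> (\<forall>K. compact K \<longrightarrow> emeasure M K < \<infinity>)"

definition atomic_measure :: "'a::topological_space set \<Rightarrow> ('a \<Rightarrow> real) \<Rightarrow> 'a measure" where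
  "atomic_measure P m = distr (point_measure P (\<lambda>p. ennreal (m p))) borel (\<lambda>p. p)"

text \<open>The weighted sum of the Dirac masses \<open>A \<mapsto> indicator A p\<close>:\<close>

lemma emeasure_atomic_measure:
  assumes "A \<in> sets borel"
  shows "emeasure (atomic_measure P m) A =
           (\<integral>\<^sup>+p. ennreal (m p) * indicator A p \<partial>count_space P)"
  using assms
  by (auto simp: atomic_measure_def point_measure_def emeasure_distr emeasure_density
      intro!: nn_integral_cong split: split_indicator)

definition gauss_mass :: "'a::euclidean_space itself \<Rightarrow> real \<Rightarrow> real" where
  "gauss_mass _ \<beta> = integral\<^sup>L lborel (\<lambda>\<xi>::'a. exp (- \<beta> * (norm \<xi>)\<^sup>2))"

definition thermal_weight :: "real \<Rightarrow> 'a::euclidean_space \<times> 'a \<Rightarrow> real" where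
  "thermal_weight \<beta> = (\<lambda>(y, z). exp (- \<beta> * (norm (y - z))\<^sup>2) / gauss_mass TYPE('a) \<beta>)"

definition thermalize :: "real \<Rightarrow> ('a::euclidean_space \<times> 'a) measure \<Rightarrow> ('a \<times> 'a) measure" where
  "thermalize \<beta> M = density M (\<lambda>x. ennreal (thermal_weight \<beta> x))"


section \<open>Real-valued measures of finite total variation\<close>

text \<open>
  A real-valued Radon measure is represented by its set function, of which only the values on Borel
  sets are relevant.  A finite positive measure \<open>M\<close> is viewed as the set function
  \<^term>\<open>measure M\<close>; this is meaningful only if \<open>M\<close> is finite, because \<^const>\<open>measure\<close> is \<open>0\<close>
  on sets of infinite measure.
\<close>

definition total_variation :: "('a::topological_space set \<Rightarrow> real) \<Rightarrow> 'a set \<Rightarrow> ennreal" where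
  "total_variation \<nu> A =
     (SUP B \<in> {B :: nat \<Rightarrow> 'a set. range B \<subseteq> sets borel \<and> disjoint_family B \<and> (\<Union>i. B i) = A}.
        \<Sum>i. ennreal \<bar>\<nu> (B i)\<bar>)"

definition bounded_measures :: "('a::topological_space set \<Rightarrow> real) set" where
  "bounded_measures =
     {\<nu>. (\<forall>A :: nat \<Rightarrow> 'a set. range A \<subseteq> sets borel \<longrightarrow> disjoint_family A \<longrightarrow>
            (\<lambda>i. \<nu> (A i)) sums \<nu> (\<Union>i. A i)) \<and>
         total_variation \<nu> UNIV < \<infinity>}"

definition TV_norm :: "('a::topological_space set \<Rightarrow> real) \<Rightarrow> ennreal" where
  "TV_norm \<nu> = total_variation \<nu> UNIV"

definition uniformly_bounded :: "('a::topological_space set \<Rightarrow> real) set \<Rightarrow> bool" where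
  "uniformly_bounded \<M> \<longleftrightarrow> \<M> \<subseteq> bounded_measures \<and>
     (\<exists>C::real. C > 0 \<and> (\<forall>\<nu>\<in>\<M>. total_variation \<nu> UNIV < ennreal C))"

definition uniformly_tight :: "('a::topological_space set \<Rightarrow> real) set \<Rightarrow> bool" where
  "uniformly_tight \<M> \<longleftrightarrow> \<M> \<subseteq> bounded_measures \<and>
     (\<forall>e::real. e > 0 \<longrightarrow>
        (\<exists>K. compact K \<and> (\<forall>\<nu>\<in>\<M>. total_variation \<nu> (UNIV - K) < ennreal e)))"

text \<open>
  Jordan decomposition: the positive part of \<open>\<nu>\<close> is \<open>(\<bar>\<nu>\<bar> + \<nu>) / 2\<close>, and the negative part is the
  positive part of \<open>-\<nu>\<close>.
\<close>

definition jordan_pos :: "('a::topological_space set \<Rightarrow> real) \<Rightarrow> 'a measure" where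
  "jordan_pos \<nu> = measure_of UNIV (sets borel)
     (\<lambda>A. ennreal ((enn2real (total_variation \<nu> A) + \<nu> A) / 2))"

definition signed_integral :: "('a::topological_space set \<Rightarrow> real) \<Rightarrow> ('a \<Rightarrow> real) \<Rightarrow> real" where
  "signed_integral \<nu> f =
     (\<integral>x. f x \<partial>jordan_pos \<nu>) - (\<integral>x. f x \<partial>jordan_pos (\<lambda>A. - \<nu> A))"


section \<open>Flat norm\<close>

definition bounded_lipschitz :: "('a::metric_space \<Rightarrow> real) \<Rightarrow> bool" where
  "bounded_lipschitz f \<longleftrightarrow> bounded (range f) \<and> (\<exists>L. L-lipschitz_on UNIV f)"

definition BL_norm :: "real \<Rightarrow> ('a::metric_space \<Rightarrow> real) \<Rightarrow> real" where
  "BL_norm l f = max (SUP x. \<bar>f x\<bar>) (l * Inf {L. L-lipschitz_on UNIV f})"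

text \<open>
  Truncation of negative integrals at \<open>0\<close> does not change the supremum, as \<open>f = 0\<close> is admissible.
\<close>

definition flat_norm :: "real \<Rightarrow> ('a::metric_space set \<Rightarrow> real) \<Rightarrow> ennreal" where
  "flat_norm l \<nu> =
     (SUP f \<in> {f. bounded_lipschitz f \<and> BL_norm l f \<le> 1}. ennreal (signed_integral \<nu> f))"

end

theory Submission
  imports Defs
begin

text \<open>
  Only the first factor of the product measures differs, so integrating out the second variable reduces
  the claim to functions of one variable. For an admissible \<open>g\<close> and \<open>b = \<beta> h\<close>, let \<open>H y\<close> be the integral of
  \<open>g (y, z) * exp (- b * (norm (y - z))\<^sup>2)\<close> against \<open>\<mu>E\<close> in \<open>z\<close>. Up to the normalising constant, the two
  thermalized measures assign to \<open>g\<close> the weighted sum of \<open>H\<close> over the nodes and the integral of \<open>H\<close> against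
  \<open>\<mu>D\<close>. The latter splits into integrals over the cells, and it remains to compare \<open>m h p * H p\<close> with the
  integral of \<open>H\<close> over the cell \<open>A h p\<close>.
  
  Replacing \<open>m h p\<close> by the mass of the cell costs the relative error \<open>\<delta> h\<close>. Replacing \<open>H y\<close> by \<open>H p\<close> costs
  \<open>sqrt b * norm (y - p)\<close> times a wider Gaussian potential at \<open>p\<close>: a Gaussian with exponent \<open>b\<close> varies on the
  length \<open>1 / sqrt b\<close>, and the Gaussians centred at \<open>y\<close> that appear in the increment are dominated by wider
  ones centred at \<open>p\<close>, because \<open>z \<in> E\<close> cannot, beyond the scale \<open>\<epsilon> h\<close>, be much closer to \<open>y\<close> than to \<open>p\<close> (lemma
  \<open>weighted_gaussian_diff_le\<close>). Integrated over the cell, the distance contributes at most \<open>\<epsilon> h\<close> times the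
  mass of the cell (lemma \<open>first_moment_le\<close>).
  
  All errors have now the form of the mass of a cell times a Gaussian potential at its node. By the second
  moment bound, the mass of a cell is concentrated around the node at scale \<open>\<epsilon> h\<close>, which does not exceed the
  length \<open>1 / sqrt b\<close> by more than a constant factor. Hence this product is at most a constant times the
  integral over the cell of a still wider potential (lemma \<open>gauss_potential_le_cell_average\<close>, an
  application of Jensen's inequality). The sum over the cells is the total mass of \<open>\<mu>\<close> thermalized at
  \<open>b / (4 * c\<^sup>2)\<close>, up to a constant, and as soon as this inverse temperature exceeds \<open>\<beta>0\<close> it is
  bounded by the supremum on the right-hand side.
  
  Two further ingredients translate this into the flat norm. The restriction of the Hausdorff measure to an
  affine subspace is sigma-finite (lemma \<open>sigma_finite_hausdorff_affine\<close>), so that integrals can be iterated;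
  and integrating against the Jordan decomposition of a difference of finite measures gives the difference of
  the integrals (lemma \<open>signed_integral_diff_measure\<close>).
\<close>

section \<open>Elementary estimates for Gaussians\<close>

lemma exp_neg_square_half_diff_le:
  fixes s t :: real
  shows "\<bar>exp (- (s\<^sup>2) / 2) - exp (- (t\<^sup>2) / 2)\<bar> \<le> \<bar>s - t\<bar>"
proof -
  have "norm (exp (- (s\<^sup>2) / 2) - exp (- (t\<^sup>2) / 2)) \<le> 1 * norm (s - t)"
  proof (rule field_differentiable_bound[where S = UNIV and f' = "\<lambda>x. - x * exp (- (x\<^sup>2) / 2)"])
    fix x :: real
    show "((\<lambda>x. exp (- (x\<^sup>2) / 2)) has_field_derivative - x * exp (- (x\<^sup>2) / 2)) (at x within UNIV)"
      by (auto intro!: derivative_eq_intros simp: power2_eq_square)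
    have "0 \<le> (\<bar>x\<bar> - 1)\<^sup>2"
      by simp
    then have "\<bar>x\<bar> \<le> 1 + x\<^sup>2 / 2"
      by (simp add: power2_diff)
    also have "\<dots> \<le> exp (x\<^sup>2 / 2)"
      by (rule exp_ge_add_one_self)
    finally show "norm (- x * exp (- (x\<^sup>2) / 2)) \<le> 1"
      by (simp add: abs_mult exp_minus field_simps)
  qed auto
  then show ?thesis
    by simp
qed

text \<open>
  A Gaussian is the square of a wider Gaussian. Factoring the difference of two squares leaves a
  difference of the wider Gaussians, which are Lipschitz with constant \<open>sqrt b\<close>, times a sum that
  still decays. This is where the rate \<open>sqrt b\<close> times distance comes from; the price is the halved
  exponent on the right.
\<close>

lemma gaussian_diff_le:
  fixes s t b :: real
  assumes "0 \<le> b"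
  shows "\<bar>exp (- b * s\<^sup>2) - exp (- b * t\<^sup>2)\<bar>
           \<le> sqrt b * \<bar>s - t\<bar> * (exp (- (b / 2) * s\<^sup>2) + exp (- (b / 2) * t\<^sup>2))"
proof -
  have square: "exp (- b * u\<^sup>2) = (exp (- (b / 2) * u\<^sup>2))\<^sup>2" for u
    by (simp add: power2_eq_square flip: exp_add)
  have root: "exp (- ((sqrt b * u)\<^sup>2) / 2) = exp (- (b / 2) * u\<^sup>2)" for u
    using assms by (simp add: power_mult_distrib)
  have lip: "\<bar>exp (- (b / 2) * s\<^sup>2) - exp (- (b / 2) * t\<^sup>2)\<bar> \<le> sqrt b * \<bar>s - t\<bar>"
    using exp_neg_square_half_diff_le[of "sqrt b * s" "sqrt b * t"] assms
    unfolding root by (simp add: abs_mult flip: right_diff_distrib)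
  have "\<bar>exp (- b * s\<^sup>2) - exp (- b * t\<^sup>2)\<bar>
      = \<bar>exp (- (b / 2) * s\<^sup>2) - exp (- (b / 2) * t\<^sup>2)\<bar>
          * (exp (- (b / 2) * s\<^sup>2) + exp (- (b / 2) * t\<^sup>2))"
    unfolding square[of s] square[of t]
    by (simp add: power2_eq_square square_diff_square_factored abs_mult mult.commute)
  also have "\<dots> \<le> sqrt b * \<bar>s - t\<bar> * (exp (- (b / 2) * s\<^sup>2) + exp (- (b / 2) * t\<^sup>2))"
    by (intro mult_right_mono lip) simp
  finally show ?thesis .
qed

text \<open>
  The graph of \<open>\<lambda>t. exp (- b * t)\<close> lies above its tangent at \<open>s\<close>. The negative term of the tangent is
  moved to the right, so that for \<open>b, s, t \<ge> 0\<close> both sides can be integrated as nonnegative functions.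
\<close>

lemma exp_tangent_le:
  fixes b s t :: real
  shows "exp (- b * s) * (1 + b * s) \<le> exp (- b * t) + exp (- b * s) * (b * t)"
proof -
  have "exp (- b * s) * (1 + b * (s - t)) \<le> exp (- b * s) * exp (b * (s - t))"
    by (intro mult_left_mono exp_ge_add_one_self) simp
  also have "\<dots> = exp (- b * t)"
    by (simp add: right_diff_distrib flip: exp_add)
  finally show ?thesis
    by (simp add: algebra_simps)
qed

text \<open>
  Normalising constants at comparable inverse temperatures are comparable; hence an estimate that
  loses a fixed factor in \<open>b\<close> survives normalisation at the price of a constant.
\<close>

lemma gauss_mass_scale:
  assumes "0 < t"
  shows "gauss_mass TYPE('a::euclidean_space) (t\<^sup>2 * b) = gauss_mass TYPE('a) b / t ^ DIM('a)"
proof -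
  have "gauss_mass TYPE('a) b = integral\<^sup>L (density (distr lborel borel (\<lambda>x::'a. 0 + t *\<^sub>R x)) (\<lambda>_. \<bar>t\<bar> ^ DIM('a)))
                                 (\<lambda>x. exp (- b * (norm x)\<^sup>2))"
    unfolding gauss_mass_def using assms by (subst lborel_affine[of t 0]) auto
  also have "\<dots> = t ^ DIM('a) * integral\<^sup>L lborel (\<lambda>x::'a. exp (- b * (norm (t *\<^sub>R x))\<^sup>2))"
    using assms by (subst integral_density) (auto simp: integral_distr)
  also have "integral\<^sup>L lborel (\<lambda>x::'a. exp (- b * (norm (t *\<^sub>R x))\<^sup>2)) = gauss_mass TYPE('a) (t\<^sup>2 * b)"
    unfolding gauss_mass_def using assms by (simp add: power_mult_distrib mult_ac)
  finally show ?thesis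
    using assms by simp
qed

lemma gauss_mass_nonneg: "0 \<le> gauss_mass TYPE('a::euclidean_space) b"
  unfolding gauss_mass_def by (rule Bochner_Integration.integral_nonneg) simp

section \<open>Finiteness of the Hausdorff measure on affine subspaces\<close>

text \<open>
  The measure constructor returns the given set function if it is countably additive and the null
  measure otherwise. In either case the outer measure is an upper bound, and upper bounds are all that
  sigma-finiteness asks for.
\<close>

lemma emeasure_le_hausdorff_outer: "emeasure (hausdorff_measure n) A \<le> hausdorff_outer n A"
  unfolding hausdorff_measure_def by (simp add: emeasure_measure_of_conv)

lemma sets_hausdorff_measure[simp, measurable_cong]: "sets (hausdorff_measure n) = sets borel"
  unfolding hausdorff_measure_def
  by (metis sets.sets_measure_of_eq space_borel)

text \<open>
  In orthonormal coordinates of \<open>E\<close> a bounded set is covered by about \<open>(2 R k) ^ n\<close> grid cells of side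
  \<open>1 / k\<close>, each of diameter at most \<open>n / k\<close>. The powers of \<open>k\<close> cancel in the covering sum, so the
  premeasures stay below one constant however small the cells are.
\<close>

lemma hausdorff_outer_bounded_affine_finite:
  fixes E :: "'a::euclidean_space set"
  assumes E: "affine E" "aff_dim E = int n" and "bounded A" "A \<subseteq> E"
  shows "hausdorff_outer n A < \<infinity>"
proof -
  from E obtain a where "a \<in> E"
    by fastforce
  define V where "V = (\<lambda>x. - a + x) ` E"
  have "subspace V"
    unfolding V_def using affine_diffs_subspace \<open>a \<in> E\<close> E(1) by blast
  have dim: "dim V = n"
    using aff_dim_eq_dim[OF hull_inc[OF \<open>a \<in> E\<close>]] E(2) unfolding V_def by simp
  obtain B where B: "B \<subseteq> V" "pairwise orthogonal B" "\<And>x. x \<in> B \<Longrightarrow> norm x = 1"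
    "independent B" "card B = dim V" "span B = V"
    using orthonormal_basis_subspace[OF \<open>subspace V\<close>] by metis
  have "finite B"
    using B(4) independent_imp_finite by blast
  have unit: "b \<bullet> b = 1" if "b \<in> B" for b
    using B(3)[OF that] by (simp add: norm_eq_1)
  have expand: "x = (\<Sum>b\<in>B. (b \<bullet> x) *\<^sub>R b)" if "x \<in> V" for x
  proof -
    let ?y = "x - (\<Sum>b\<in>B. (b \<bullet> x / (b \<bullet> b)) *\<^sub>R b)"
    have "?y \<in> span B"
      using that B(6) by (intro span_diff span_sum span_scale) (auto intro: span_base)
    then have "orthogonal ?y ?y"
      using Gram_Schmidt_step[OF B(2)] by blast
    then show ?thesis
      using unit by (simp add: orthogonal_self cong: sum.cong)
  qed
  obtain R0 where R0: "\<And>x. x \<in> A \<Longrightarrow> norm (x - a) \<le> R0"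
    using \<open>bounded A\<close> unfolding bounded_def by (metis dist_norm dist_commute bounded_any_center[THEN iffD1, OF \<open>bounded A\<close>])
  obtain R :: nat where "R0 \<le> R"
    using real_arch_simple by blast
  then have R: "norm (x - a) \<le> R" if "x \<in> A" for x
    using R0[OF that] by simp
  \<comment> \<open>Integer points \<open>j\<close> index the cells of side \<open>1 / k\<close>; \<open>J k\<close> includes all those that meet the ball of radius \<open>R\<close>.\<close>
  define cell where "cell k j = {x \<in> E. \<forall>b\<in>B. real_of_int (j b) / real k \<le> b \<bullet> (x - a)
      \<and> b \<bullet> (x - a) \<le> (real_of_int (j b) + 1) / real k}" for k :: nat and j :: "'a \<Rightarrow> int"
  define J where "J k = (PiE B (\<lambda>_. {- int (R * k)..int (R * k)}))" for k
  define c where "c = unit_ball_vol (real n) * (real (2 * R + 1) * real n / 2) ^ n"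
  have "card {- int (R * k)..int (R * k)} = 2 * (R * k) + 1" for k
    unfolding card_atLeastAtMost_int by linarith
  then have J: "finite (J k)" "card (J k) = (2 * (R * k) + 1) ^ n" for k
    unfolding J_def using \<open>finite B\<close> B(5) dim
    by (auto intro!: finite_PiE simp: card_PiE simp del: card_atLeastAtMost_int)
  have cell_small: "norm (x - y) \<le> n / k" if "x \<in> cell k j" "y \<in> cell k j" "k > 0" for x y k j
  proof -
    have "- a + x \<in> V" "- a + y \<in> V"
      using that unfolding cell_def V_def by blast+
    then have "x - y \<in> V"
      using subspace_diff[OF \<open>subspace V\<close>] by fastforce
    then have "norm (x - y) = norm (\<Sum>b\<in>B. (b \<bullet> (x - y)) *\<^sub>R b)"
      using expand by metis
    also have "\<dots> \<le> (\<Sum>b\<in>B. \<bar>b \<bullet> (x - y)\<bar>)"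
      by (rule sum_norm_le) (simp add: B(3))
    also have "\<dots> \<le> (\<Sum>b\<in>B. 1 / k)"
    proof (rule sum_mono)
      fix b assume "b \<in> B"
      then have "real_of_int (j b) / k \<le> b \<bullet> (x - a)" "b \<bullet> (x - a) \<le> (j b + 1) / k"
        "real_of_int (j b) / k \<le> b \<bullet> (y - a)" "b \<bullet> (y - a) \<le> (j b + 1) / k"
        using that unfolding cell_def by auto
      then show "\<bar>b \<bullet> (x - y)\<bar> \<le> 1 / k"
        by (simp add: inner_diff_right add_divide_distrib abs_le_iff)
    qed
    also have "\<dots> = n / k"
      using B(5) dim by simp
    finally show ?thesis .
  qed
  have pre: "hausdorff_pre n d A \<le> ennreal c" if "d > 0" for d
  proof -
    obtain k :: nat where k: "n / d < k"
      using reals_Archimedean2 by blast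
    have "k > 0"
      using k that by (metis divide_nonneg_pos of_nat_0_le_iff of_nat_0_less_iff order_le_less_trans)
    have kd: "n / k \<le> d"
      using k \<open>k > 0\<close> that by (simp add: field_simps)
    obtain e where e: "bij_betw e {..<card (J k)} (J k)"
      using J(1) ex_bij_betw_nat_finite[of "J k"] by (auto simp: atLeast0LessThan)
    define C where "C i = (if i < card (J k) then cell k (e i) else {})" for i
    have diamC: "diameter (C i) \<le> n / k" for i
      unfolding C_def using cell_small \<open>k > 0\<close> by (auto intro!: diameter_le)
    have "bounded (C i)" for i
    proof (cases "C i = {}")
      case False
      then obtain x where "x \<in> C i"
        by blast
      then show ?thesis
        unfolding bounded_def using cell_small[OF _ _ \<open>k > 0\<close>, of x "e i"]
        by (intro exI[of _ x] exI[of _ "n / k"]) (auto simp: dist_norm C_def split: if_splits)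
    qed simp
    moreover have "A \<subseteq> (\<Union>i. C i)"
    proof
      fix x assume "x \<in> A"
      define j where "j = (\<lambda>b\<in>B. \<lfloor>(b \<bullet> (x - a)) * k\<rfloor>)"
      have "j \<in> J k"
        unfolding J_def j_def
      proof (rule restrict_PiE_iff[THEN iffD2], rule ballI)
        fix b assume "b \<in> B"
        have "\<bar>b \<bullet> (x - a)\<bar> \<le> R"
          using Cauchy_Schwarz_ineq2[of b "x - a"] B(3)[OF \<open>b \<in> B\<close>] R[OF \<open>x \<in> A\<close>] by simp
        then have "\<bar>b \<bullet> (x - a) * k\<bar> \<le> R * k"
          by (simp add: abs_mult mult_right_mono)
        then show "\<lfloor>b \<bullet> (x - a) * k\<rfloor> \<in> {- int (R * k)..int (R * k)}"
          by (simp add: le_floor_iff floor_le_iff abs_le_iff)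
      qed
      then obtain i where "i < card (J k)" "e i = j"
        using e by (metis bij_betw_iff_bijections lessThan_iff)
      moreover have "x \<in> cell k j"
        unfolding cell_def j_def using \<open>x \<in> A\<close> \<open>A \<subseteq> E\<close> \<open>k > 0\<close>
        by (auto simp: pos_divide_le_eq pos_le_divide_eq)
      ultimately show "x \<in> (\<Union>i. C i)"
        unfolding C_def by (intro UN_I[of i]) auto
    qed
    ultimately have "hausdorff_pre n d A
        \<le> (\<Sum>i. if C i = {} then 0 else ennreal (unit_ball_vol (real n) * (diameter (C i) / 2) ^ n))"
      unfolding hausdorff_pre_def using order_trans[OF diamC kd] by (intro INF_lower) auto
    also have "\<dots> = (\<Sum>i<card (J k). if C i = {} then 0 else ennreal (unit_ball_vol (real n) * (diameter (C i) / 2) ^ n))"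
      by (rule suminf_finite) (auto simp: C_def)
    also have "\<dots> \<le> (\<Sum>i<card (J k). ennreal (unit_ball_vol (real n) * (n / k / 2) ^ n))"
      using diamC
      by (intro sum_mono) (auto intro!: ennreal_leI mult_left_mono power_mono divide_right_mono diameter_ge_0 \<open>\<And>i. bounded (C i)\<close>)
    also have "\<dots> = ennreal (real (card (J k)) * (unit_ball_vol (real n) * (n / k / 2) ^ n))"
      by (simp add: ennreal_mult ennreal_of_nat_eq_real_of_nat)
    also have "\<dots> \<le> ennreal c"
    proof (rule ennreal_leI)
      have "real (card (J k)) \<le> (real (2 * R + 1) * k) ^ n"
        unfolding J(2) of_nat_power using \<open>k > 0\<close> by (intro power_mono) (auto simp: algebra_simps)
      then have "real (card (J k)) * (unit_ball_vol (real n) * (n / k / 2) ^ n)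
          \<le> (real (2 * R + 1) * k) ^ n * (unit_ball_vol (real n) * (n / k / 2) ^ n)"
        by (intro mult_right_mono) auto
      also have "\<dots> = unit_ball_vol (real n) * ((real (2 * R + 1) * k) * (n / k / 2)) ^ n"
        by (simp only: power_mult_distrib ac_simps)
      also have "(real (2 * R + 1) * k) * (n / k / 2) = real (2 * R + 1) * real n / 2"
        using \<open>k > 0\<close> by simp
      also have "unit_ball_vol (real n) * \<dots> ^ n = c"
        unfolding c_def ..
      finally show "real (card (J k)) * (unit_ball_vol (real n) * (n / k / 2) ^ n) \<le> c" .
    qed
    finally show ?thesis .
  qed
  have "hausdorff_outer n A \<le> ennreal c"
    unfolding hausdorff_outer_def using pre by (intro SUP_least) auto
  also have "\<dots> < \<infinity>"
    by simp
  finally show ?thesis .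
qed

text \<open>
  Sigma-finiteness is what makes iterated integrals against product measures with this factor available.
\<close>

lemma sigma_finite_hausdorff_affine:
  fixes E :: "'a::euclidean_space set"
  assumes E: "affine E" "aff_dim E = int n"
  shows "sigma_finite_measure (measure_restr (hausdorff_measure n) E)"
proof
  have [measurable]: "E \<in> sets borel"
    using E(1) by (simp add: affine_closed)
  have "emeasure (measure_restr (hausdorff_measure n) E) (cball 0 r) \<noteq> \<infinity>" for r :: real
  proof -
    have "emeasure (measure_restr (hausdorff_measure n) E) (cball 0 r) = emeasure (hausdorff_measure n) (E \<inter> cball 0 r)"
      unfolding measure_restr_def by (subst emeasure_restricted) auto
    also have "\<dots> \<le> hausdorff_outer n (E \<inter> cball 0 r)"
      by (rule emeasure_le_hausdorff_outer)
    also have "\<dots> < \<infinity>"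
      using E by (rule hausdorff_outer_bounded_affine_finite) auto
    finally show ?thesis
      by simp
  qed
  moreover have "(\<Union>k::nat. cball (0::'a) (real k)) = UNIV"
    using real_arch_simple by (auto simp: set_eq_iff)
  moreover have "space (measure_restr (hausdorff_measure n) E) = UNIV"
    unfolding measure_restr_def hausdorff_measure_def by simp
  ultimately show "\<exists>A. countable A \<and> A \<subseteq> sets (measure_restr (hausdorff_measure n) E) \<and>
      \<Union> A = space (measure_restr (hausdorff_measure n) E) \<and>
      (\<forall>a\<in>A. emeasure (measure_restr (hausdorff_measure n) E) a \<noteq> \<infinity>)"
    by (intro exI[of _ "range (\<lambda>k::nat. cball 0 (real k))"]) (auto simp: measure_restr_def)
qed

section \<open>Signed integrals against differences of finite measures\<close>

text \<open>
  An equality between sums of measures cannot be rewritten with differences when masses may be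
  infinite; stated with two measures on each side, it passes from sets to functions by monotone
  approximation without any subtraction.
\<close>

lemma nn_integral_add_measures_eq:
  assumes sets: "sets M2 = sets M1" "sets N1 = sets M1" "sets N2 = sets M1"
    and eq: "\<And>A. A \<in> sets M1 \<Longrightarrow> emeasure M1 A + emeasure M2 A = emeasure N1 A + emeasure N2 A"
    and f: "f \<in> borel_measurable M1"
  shows "(\<integral>\<^sup>+x. f x \<partial>M1) + (\<integral>\<^sup>+x. f x \<partial>M2) = (\<integral>\<^sup>+x. f x \<partial>N1) + (\<integral>\<^sup>+x. f x \<partial>N2)"
proof -
  have meas: "u \<in> borel_measurable M" if "u \<in> borel_measurable M1" "sets M = sets M1"
    for u :: "'a \<Rightarrow> ennreal" and M
    using that by (simp add: measurable_cong_sets[OF that(2) refl])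
  show ?thesis
    using f
  proof (induction rule: borel_measurable_induct)
    case (cong f g)
    have "integral\<^sup>N M f = integral\<^sup>N M g" if "sets M = sets M1" for M
      using cong sets_eq_imp_space_eq[OF that] by (intro nn_integral_cong) auto
    then show ?case
      using cong sets by simp
  next
    case (set A)
    then show ?case
      using sets eq by simp
  next
    case (mult u c)
    have "(\<integral>\<^sup>+x. c * u x \<partial>M) = c * integral\<^sup>N M u" if "sets M = sets M1" for M
      using meas[OF mult(2) that] by (rule nn_integral_cmult)
    then show ?case
      using mult sets by (simp flip: distrib_left)
  next
    case (add u v)
    have split: "(\<integral>\<^sup>+x. v x + u x \<partial>M) = integral\<^sup>N M v + integral\<^sup>N M u" if "sets M = sets M1" for M
      using meas[OF add.hyps(3) that] meas[OF add.hyps(1) that] by (rule nn_integral_add)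
    have "(\<integral>\<^sup>+x. v x + u x \<partial>M1) + (\<integral>\<^sup>+x. v x + u x \<partial>M2)
        = (integral\<^sup>N M1 v + integral\<^sup>N M2 v) + (integral\<^sup>N M1 u + integral\<^sup>N M2 u)"
      unfolding split[OF refl] split[OF sets(1)] by (simp only: ac_simps)
    also have "\<dots> = (\<integral>\<^sup>+x. v x + u x \<partial>N1) + (\<integral>\<^sup>+x. v x + u x \<partial>N2)"
      unfolding add.IH split[OF sets(2)] split[OF sets(3)] by (simp only: ac_simps)
    finally show ?case .
  next
    case (seq U)
    have mono: "integral\<^sup>N M (SUP i. U i) = (SUP i. integral\<^sup>N M (U i))" if "sets M = sets M1" for M
      using nn_integral_monotone_convergence_SUP[OF seq.hyps(3) meas[OF seq.hyps(1) that]] by (simp add: image_comp[symmetric] SUP_apply[abs_def])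
    have inc: "incseq (\<lambda>i. integral\<^sup>N M (U i))" for M
      using seq.hyps(3) by (auto intro!: nn_integral_mono simp: incseq_def le_fun_def)
    have "(SUP i. integral\<^sup>N M1 (U i)) + (SUP i. integral\<^sup>N M2 (U i))
        = (SUP i. integral\<^sup>N N1 (U i)) + (SUP i. integral\<^sup>N N2 (U i))"
      using seq.IH by (simp add: ennreal_SUP_add[OF inc inc, symmetric])
    then show ?case
      unfolding mono[OF refl] mono[OF sets(1)] mono[OF sets(2)] mono[OF sets(3)] .
  qed
qed

lemma integral_add_measures_eq:
  fixes f :: "'a \<Rightarrow> real"
  assumes "finite_measure M1" "finite_measure M2" "finite_measure N1" "finite_measure N2"
    and sets: "sets M2 = sets M1" "sets N1 = sets M1" "sets N2 = sets M1"
    and eq: "\<And>A. A \<in> sets M1 \<Longrightarrow> emeasure M1 A + emeasure M2 A = emeasure N1 A + emeasure N2 A"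
    and f: "f \<in> borel_measurable M1" "\<And>x. \<bar>f x\<bar> \<le> c"
  shows "(\<integral>x. f x \<partial>M1) + (\<integral>x. f x \<partial>M2) = (\<integral>x. f x \<partial>N1) + (\<integral>x. f x \<partial>N2)"
proof -
  have split: "integrable M f" "integral\<^sup>L M f = enn2real (\<integral>\<^sup>+x. ennreal (f x) \<partial>M) - enn2real (\<integral>\<^sup>+x. ennreal (- f x) \<partial>M)"
    "(\<integral>\<^sup>+x. ennreal (f x) \<partial>M) < \<infinity>" "(\<integral>\<^sup>+x. ennreal (- f x) \<partial>M) < \<infinity>"
    if "finite_measure M" "sets M = sets M1" for M
  proof -
    interpret finite_measure M by fact
    show int: "integrable M f"
      using f that(2) by (intro integrable_const_bound[of _ c]) (auto simp: measurable_cong_sets[OF that(2) refl])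
    then show "integral\<^sup>L M f = enn2real (\<integral>\<^sup>+x. ennreal (f x) \<partial>M) - enn2real (\<integral>\<^sup>+x. ennreal (- f x) \<partial>M)"
      by (rule real_lebesgue_integral_def)
    show "(\<integral>\<^sup>+x. ennreal (f x) \<partial>M) < \<infinity>" "(\<integral>\<^sup>+x. ennreal (- f x) \<partial>M) < \<infinity>"
      using int by (auto simp: real_integrable_def less_top)
  qed
  have real_eq: "enn2real a1 + enn2real a2 = enn2real b1 + enn2real b2"
    if "a1 + a2 = b1 + b2" "a1 < \<infinity>" "a2 < \<infinity>" "b1 < \<infinity>" "b2 < \<infinity>" for a1 a2 b1 b2 :: ennreal
    using that by (metis enn2real_plus infinity_ennreal_def)
  note P = split[OF assms(1) refl] split[OF assms(2) sets(1)] split[OF assms(3) sets(2)] split[OF assms(4) sets(3)]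
  have "enn2real (\<integral>\<^sup>+x. ennreal (f x) \<partial>M1) + enn2real (\<integral>\<^sup>+x. ennreal (f x) \<partial>M2)
      = enn2real (\<integral>\<^sup>+x. ennreal (f x) \<partial>N1) + enn2real (\<integral>\<^sup>+x. ennreal (f x) \<partial>N2)"
    using P f(1) by (intro real_eq nn_integral_add_measures_eq[OF sets eq]) auto
  moreover have "enn2real (\<integral>\<^sup>+x. ennreal (- f x) \<partial>M1) + enn2real (\<integral>\<^sup>+x. ennreal (- f x) \<partial>M2)
      = enn2real (\<integral>\<^sup>+x. ennreal (- f x) \<partial>N1) + enn2real (\<integral>\<^sup>+x. ennreal (- f x) \<partial>N2)"
    using P f(1) by (intro real_eq nn_integral_add_measures_eq[OF sets eq]) auto
  ultimately show ?thesis
    using P by simp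
qed

text \<open>
  On a Hahn set \<open>Y\<close> of the difference the signed measure is nonnegative and off \<open>Y\<close> it is nonpositive.
  Splitting every piece of a partition along \<open>Y\<close> only increases the sum of absolute values, so the
  partition of \<open>A\<close> into \<open>A \<inter> Y\<close> and \<open>A - Y\<close> is optimal.
\<close>

lemma total_variation_diff_measure:
  fixes M N :: "'a::topological_space measure"
  assumes fin: "finite_measure M" "finite_measure N" and sets: "sets M = sets borel" "sets N = sets borel"
    and Y: "Y \<in> sets borel" "\<forall>X\<in>sets borel. X \<subseteq> Y \<longrightarrow> measure N X \<le> measure M X"
      "\<forall>X\<in>sets borel. X \<inter> Y = {} \<longrightarrow> measure M X \<le> measure N X"
    and A: "A \<in> sets borel"
  shows "total_variation (\<lambda>S. measure M S - measure N S) A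
    = ennreal ((measure M (A \<inter> Y) - measure N (A \<inter> Y)) + (measure N (A - Y) - measure M (A - Y)))"
proof (rule antisym)
  interpret M: finite_measure M by fact
  interpret N: finite_measure N by fact
  have union_M: "measure M X = measure M (X \<inter> Y) + measure M (X - Y)" if "X \<in> sets borel" for X
    using that Y(1) M.finite_measure_Union[of "X \<inter> Y" "X - Y"] by (simp add: sets Int_Diff_Un Int_Diff_disjoint)
  have union_N: "measure N X = measure N (X \<inter> Y) + measure N (X - Y)" if "X \<in> sets borel" for X
    using that Y(1) N.finite_measure_Union[of "X \<inter> Y" "X - Y"] by (simp add: sets Int_Diff_Un Int_Diff_disjoint)
  have pos: "measure N (X \<inter> Y) \<le> measure M (X \<inter> Y)" "measure M (X - Y) \<le> measure N (X - Y)" if "X \<in> sets borel" for X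
    using that Y(1) Y(2)[rule_format, of "X \<inter> Y"] Y(3)[rule_format, of "X - Y"] by auto
  show "total_variation (\<lambda>S. measure M S - measure N S) A
    \<le> ennreal ((measure M (A \<inter> Y) - measure N (A \<inter> Y)) + (measure N (A - Y) - measure M (A - Y)))"
    unfolding total_variation_def
  proof (rule SUP_least, safe)
    fix B :: "nat \<Rightarrow> 'a set" assume B: "range B \<subseteq> sets borel" "disjoint_family B" "A = (\<Union>i. B i)"
    have 1: "range (\<lambda>i. B i \<inter> Y) \<subseteq> sets borel" "range (\<lambda>i. B i - Y) \<subseteq> sets borel"
      "disjoint_family (\<lambda>i. B i \<inter> Y)" "disjoint_family (\<lambda>i. B i - Y)"
      using B Y(1) by (auto simp: disjoint_family_on_def)
    define g where "g i = (measure M (B i \<inter> Y) - measure N (B i \<inter> Y)) + (measure N (B i - Y) - measure M (B i - Y))" for i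
    have "g sums ((measure M (\<Union>i. B i \<inter> Y) - measure N (\<Union>i. B i \<inter> Y)) + (measure N (\<Union>i. B i - Y) - measure M (\<Union>i. B i - Y)))"
      unfolding g_def using 1
      by (intro sums_add sums_diff M.finite_measure_UNION N.finite_measure_UNION) (auto simp: sets)
    then have g: "g sums ((measure M (A \<inter> Y) - measure N (A \<inter> Y)) + (measure N (A - Y) - measure M (A - Y)))"
      using B(3) by simp
    have g0: "0 \<le> g i" for i
      unfolding g_def using pos[of "B i"] B(1) by auto
    have "(\<Sum>i. ennreal \<bar>measure M (B i) - measure N (B i)\<bar>) \<le> (\<Sum>i. ennreal (g i))"
    proof (rule suminf_le)
      fix i
      have "B i \<in> sets borel"
        using B(1) by auto
      then show "ennreal \<bar>measure M (B i) - measure N (B i)\<bar> \<le> ennreal (g i)"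
        using union_M[of "B i"] union_N[of "B i"] pos[of "B i"] unfolding g_def by (intro ennreal_leI) auto
    qed auto
    also have "\<dots> = ennreal ((measure M (A \<inter> Y) - measure N (A \<inter> Y)) + (measure N (A - Y) - measure M (A - Y)))"
      using g g0 by (metis suminf_ennreal2 sums_iff)
    finally show "(\<Sum>i. ennreal \<bar>measure M (B i) - measure N (B i)\<bar>)
      \<le> ennreal (measure M ((\<Union>i. B i) \<inter> Y) - measure N ((\<Union>i. B i) \<inter> Y) + (measure N ((\<Union>i. B i) - Y) - measure M ((\<Union>i. B i) - Y)))"
      using B(3) by simp
  qed
  define B :: "nat \<Rightarrow> 'a set" where "B i = (if i = 0 then A \<inter> Y else if i = 1 then A - Y else {})" for i
  have "(\<Sum>i. ennreal \<bar>measure M (B i) - measure N (B i)\<bar>) = (\<Sum>i<2. ennreal \<bar>measure M (B i) - measure N (B i)\<bar>)"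
    by (rule suminf_finite) (auto simp: B_def)
  also have "\<dots> = ennreal ((measure M (A \<inter> Y) - measure N (A \<inter> Y)) + (measure N (A - Y) - measure M (A - Y)))"
    using pos[OF A] by (simp add: numeral_2_eq_2 B_def ennreal_plus[symmetric] del: ennreal_plus)
  finally have sum: "(\<Sum>i. ennreal \<bar>measure M (B i) - measure N (B i)\<bar>)
    = ennreal ((measure M (A \<inter> Y) - measure N (A \<inter> Y)) + (measure N (A - Y) - measure M (A - Y)))" .
  have "(\<Union>i. B i) = A"
    unfolding B_def by (auto split: if_splits)
  moreover have "range B \<subseteq> sets borel" "disjoint_family B"
    using A Y(1) by (auto simp: B_def disjoint_family_on_def)
  ultimately show "ennreal ((measure M (A \<inter> Y) - measure N (A \<inter> Y)) + (measure N (A - Y) - measure M (A - Y)))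
    \<le> total_variation (\<lambda>S. measure M S - measure N S) A"
    unfolding total_variation_def sum[symmetric] by (intro SUP_upper) auto
qed

text \<open>
  Averaging the total variation with the signed measure cancels the part off the Hahn set. The result
  is countably additive, so the measure constructor in the Jordan decomposition returns it.
\<close>

lemma jordan_pos_diff_measure:
  fixes M N :: "'a::topological_space measure"
  assumes fin: "finite_measure M" "finite_measure N" and sets: "sets M = sets borel" "sets N = sets borel"
    and Y: "Y \<in> sets borel" "\<forall>X\<in>sets borel. X \<subseteq> Y \<longrightarrow> measure N X \<le> measure M X"
      "\<forall>X\<in>sets borel. X \<inter> Y = {} \<longrightarrow> measure M X \<le> measure N X"
    and A: "A \<in> sets borel"
  shows "emeasure (jordan_pos (\<lambda>S. measure M S - measure N S)) A = ennreal (measure M (A \<inter> Y) - measure N (A \<inter> Y))"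
proof -
  interpret M: finite_measure M by fact
  interpret N: finite_measure N by fact
  have split: "measure M X = measure M (X \<inter> Y) + measure M (X - Y)" "measure N X = measure N (X \<inter> Y) + measure N (X - Y)"
    if "X \<in> sets borel" for X
    using that Y(1) M.finite_measure_Union[of "X \<inter> Y" "X - Y"] N.finite_measure_Union[of "X \<inter> Y" "X - Y"]
    by (simp_all add: sets Int_Diff_Un Int_Diff_disjoint)
  have pos: "measure N (X \<inter> Y) \<le> measure M (X \<inter> Y)" "measure M (X - Y) \<le> measure N (X - Y)" if "X \<in> sets borel" for X
    using that Y(1) Y(2)[rule_format, of "X \<inter> Y"] Y(3)[rule_format, of "X - Y"] by auto
  have val: "ennreal ((enn2real (total_variation (\<lambda>S. measure M S - measure N S) X) + (measure M X - measure N X)) / 2)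
      = ennreal (measure M (X \<inter> Y) - measure N (X \<inter> Y))" if "X \<in> sets borel" for X
  proof -
    have "total_variation (\<lambda>S. measure M S - measure N S) X
        = ennreal ((measure M (X \<inter> Y) - measure N (X \<inter> Y)) + (measure N (X - Y) - measure M (X - Y)))"
      by (rule total_variation_diff_measure[OF fin sets Y that])
    then show ?thesis
      using pos[OF that] split[OF that] by (simp del: ennreal_plus)
  qed
  define g where "g X = ennreal ((enn2real (total_variation (\<lambda>S. measure M S - measure N S) X)
      + (measure M X - measure N X)) / 2)" for X
  have g: "g X = ennreal (measure M (X \<inter> Y) - measure N (X \<inter> Y))" if "X \<in> sets borel" for X
    unfolding g_def by (rule val[OF that])
  have "countably_additive (sets borel) g"
    unfolding countably_additive_def
  proof (intro allI impI)
    fix B :: "nat \<Rightarrow> 'a set"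
    assume B: "range B \<subseteq> sets borel" and dis: "disjoint_family B" and U: "(\<Union>i. B i) \<in> sets borel"
    have B': "B i \<in> sets borel" for i
      using B by auto
    have "(\<lambda>i. measure M (B i \<inter> Y) - measure N (B i \<inter> Y)) sums
        (measure M (\<Union>i. B i \<inter> Y) - measure N (\<Union>i. B i \<inter> Y))"
      using B dis Y(1)
      by (intro sums_diff M.finite_measure_UNION N.finite_measure_UNION) (auto simp: sets disjoint_family_on_def)
    then have "(\<Sum>i. ennreal (measure M (B i \<inter> Y) - measure N (B i \<inter> Y)))
        = ennreal (measure M ((\<Union>i. B i) \<inter> Y) - measure N ((\<Union>i. B i) \<inter> Y))"
      using pos(1)[OF B'] by (subst suminf_ennreal2) (auto simp: sums_iff)
    then show "(\<Sum>i. g (B i)) = g (\<Union>i. B i)"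
      by (simp only: g[OF B'] g[OF U])
  qed
  moreover have "jordan_pos (\<lambda>S. measure M S - measure N S) = measure_of UNIV (sets borel) g"
    unfolding jordan_pos_def g_def ..
  moreover have "positive (sets borel) g"
    unfolding positive_def by (simp add: g)
  ultimately have "emeasure (jordan_pos (\<lambda>S. measure M S - measure N S)) A = g A"
    using A emeasure_measure_of_sigma[of UNIV "sets borel" g A] sets.sigma_algebra_axioms[of borel]
    by simp
  then show ?thesis
    by (simp only: g[OF A])
qed

lemma sets_jordan_pos: "sets (jordan_pos \<nu>) = sets borel"
  unfolding jordan_pos_def by (metis sets.sets_measure_of_eq space_borel)

text \<open>
  The Jordan parts are in general smaller than \<open>M\<close> and \<open>N\<close>, but the positive part plus \<open>N\<close> and the
  negative part plus \<open>M\<close> are the same measure, which makes the integrals agree.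
\<close>

lemma signed_integral_diff_measure:
  fixes M N :: "'a::topological_space measure"
  assumes fin: "finite_measure M" "finite_measure N" and sets: "sets M = sets borel" "sets N = sets borel"
    and f: "f \<in> borel_measurable borel" "\<And>x. \<bar>f x\<bar> \<le> c"
  shows "signed_integral (\<lambda>S. measure M S - measure N S) f = (\<integral>x. f x \<partial>M) - (\<integral>x. f x \<partial>N)"
proof -
  interpret M: finite_measure M by fact
  interpret N: finite_measure N by fact
  have "sets N = sets M"
    by (simp add: sets)
  from finite_unsigned_Hahn_decomposition[OF fin this] obtain Y where "Y \<in> sets M"
    and Y: "(\<forall>X\<in>sets M. X \<subseteq> Y \<longrightarrow> emeasure N X \<le> emeasure M X)
      \<and> (\<forall>X\<in>sets M. X \<inter> Y = {} \<longrightarrow> emeasure M X \<le> emeasure N X)"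
    by (rule bexE)
  then have Y1: "Y \<in> sets borel"
    by (simp add: sets)
  have Y2: "\<forall>X\<in>sets borel. X \<subseteq> Y \<longrightarrow> measure N X \<le> measure M X"
    using Y by (simp add: sets M.emeasure_eq_measure N.emeasure_eq_measure)
  have Y3: "\<forall>X\<in>sets borel. X \<inter> Y = {} \<longrightarrow> measure M X \<le> measure N X"
    using Y by (simp add: sets M.emeasure_eq_measure N.emeasure_eq_measure)
  \<comment> \<open>\<open>Y\<close> is a Hahn set for the difference, and its complement is one for the opposite difference.\<close>
  let ?P = "jordan_pos (\<lambda>S. measure M S - measure N S)"
  let ?Q = "jordan_pos (\<lambda>S. - (measure M S - measure N S))"
  have P: "emeasure ?P A = ennreal (measure M (A \<inter> Y) - measure N (A \<inter> Y))" if "A \<in> sets borel" for A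
    by (rule jordan_pos_diff_measure[OF fin sets Y1 Y2 Y3 that])
  have Q: "emeasure ?Q A = ennreal (measure N (A - Y) - measure M (A - Y))" if "A \<in> sets borel" for A
  proof -
    have "emeasure (jordan_pos (\<lambda>S. measure N S - measure M S)) A = ennreal (measure N (A \<inter> - Y) - measure M (A \<inter> - Y))"
      using Y1 Y2 Y3 that by (intro jordan_pos_diff_measure[OF fin(2,1) sets(2,1)]) (auto simp: disjoint_eq_subset_Compl)
    then show ?thesis
      by (simp add: Diff_eq)
  qed
  have sp: "space ?P = UNIV" "space ?Q = UNIV"
    by (simp_all add: jordan_pos_def)
  have finPQ: "finite_measure ?P" "finite_measure ?Q"
    using P[of UNIV] Q[of UNIV] sp by (auto intro!: finite_measureI)
  have "(\<integral>x. f x \<partial>M) + (\<integral>x. f x \<partial>?Q) = (\<integral>x. f x \<partial>N) + (\<integral>x. f x \<partial>?P)"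
  proof (rule integral_add_measures_eq)
    fix A assume "A \<in> sets M"
    then have A: "A \<in> sets borel"
      by (simp add: sets)
    have "measure M A = measure M (A \<inter> Y) + measure M (A - Y)" "measure N A = measure N (A \<inter> Y) + measure N (A - Y)"
      using A Y1 M.finite_measure_Union[of "A \<inter> Y" "A - Y"] N.finite_measure_Union[of "A \<inter> Y" "A - Y"]
      by (simp_all add: sets Int_Diff_Un Int_Diff_disjoint)
    moreover have "measure N (A \<inter> Y) \<le> measure M (A \<inter> Y)" "measure M (A - Y) \<le> measure N (A - Y)"
      using A Y1 Y2[rule_format, of "A \<inter> Y"] Y3[rule_format, of "A - Y"] by auto
    ultimately show "emeasure M A + emeasure ?Q A = emeasure N A + emeasure ?P A"
      using P[OF A] Q[OF A]
      by (simp add: M.emeasure_eq_measure N.emeasure_eq_measure ennreal_plus[symmetric] del: ennreal_plus)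
  qed (use fin finPQ sets f in \<open>auto simp: sets_jordan_pos measurable_cong_sets[OF sets(1) refl]\<close>)
  then show ?thesis
    unfolding signed_integral_def by simp
qed

section \<open>Gaussian potentials\<close>

text \<open>
  The Gaussian weight without its normalising constant, integrated against \<open>g\<close> in the second variable
  only. Integrating over \<open>y\<close> against \<open>\<nu>\<close> yields, up to that constant, the integral of \<open>g\<close> against the
  thermalized product of \<open>\<nu>\<close> and \<open>\<kappa>\<close>; the comparison between two choices of \<open>\<nu>\<close> thus becomes a
  comparison of values of one function.
\<close>

definition gauss_potential :: "'a::euclidean_space measure \<Rightarrow> real \<Rightarrow> ('a \<times> 'a \<Rightarrow> real) \<Rightarrow> 'a \<Rightarrow> ennreal" where
  "gauss_potential \<kappa> b g y = (\<integral>\<^sup>+z. ennreal (g (y, z) * exp (- b * (norm (y - z))\<^sup>2)) \<partial>\<kappa>)"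

lemma borel_measurable_gauss_potential:
  fixes \<kappa> :: "'a::euclidean_space measure"
  assumes \<kappa>: "sigma_finite_measure \<kappa>" "sets \<kappa> = sets borel"
    and g: "g \<in> borel_measurable borel"
  shows "gauss_potential \<kappa> b g \<in> borel_measurable borel"
proof -
  interpret sigma_finite_measure \<kappa> by fact
  have pair: "sets (borel \<Otimes>\<^sub>M \<kappa>) = sets (borel :: ('a \<times> 'a) measure)"
    unfolding borel_prod[symmetric] using \<kappa>(2) by (rule sets_pair_measure_cong[OF refl])
  have [measurable]: "g \<in> borel_measurable (borel \<Otimes>\<^sub>M borel)"
    using g by (simp add: borel_prod)
  have "(\<lambda>x. ennreal (g x * exp (- b * (norm (fst x - snd x))\<^sup>2))) \<in> borel_measurable (borel \<Otimes>\<^sub>M borel)"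
    by measurable
  then have "(\<lambda>(y, z). ennreal (g (y, z) * exp (- b * (norm (y - z))\<^sup>2))) \<in> borel_measurable (borel \<Otimes>\<^sub>M \<kappa>)"
    by (simp add: measurable_cong_sets[OF pair refl] split_beta' borel_prod)
  then show ?thesis
    unfolding gauss_potential_def[abs_def] by (rule borel_measurable_nn_integral)
qed

lemma gauss_potential_mono:
  assumes "b' \<le> b" "\<And>z. g (y, z) \<le> 1"
  shows "gauss_potential \<kappa> b g y \<le> gauss_potential \<kappa> b' (\<lambda>_. 1) y"
  unfolding gauss_potential_def
proof (intro nn_integral_mono ennreal_leI)
  fix z
  have "exp (- b * (norm (y - z))\<^sup>2) \<le> exp (- b' * (norm (y - z))\<^sup>2)"
    using assms(1) by (simp add: mult_right_mono)
  moreover have "g (y, z) * exp (- b * (norm (y - z))\<^sup>2) \<le> 1 * exp (- b * (norm (y - z))\<^sup>2)"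
    using assms(2) by (rule mult_right_mono) simp
  ultimately show "g (y, z) * exp (- b * (norm (y - z))\<^sup>2) \<le> 1 * exp (- b' * (norm (y - z))\<^sup>2)"
    by linarith
qed

text \<open>
  Jensen's inequality for the convex function \<open>\<lambda>t. exp (- b * t)\<close>, where \<open>f\<close> has mean at most \<open>v\<close> over \<open>S\<close>:
  integrate the tangent at \<open>v\<close> and cancel the finite linear term.
\<close>

lemma exp_neg_variance_le:
  assumes S: "S \<in> sets \<mu>" "emeasure \<mu> S < \<infinity>" and f: "f \<in> borel_measurable \<mu>" "\<And>y. 0 \<le> f y"
    and var: "(\<integral>\<^sup>+y\<in>S. ennreal (f y) \<partial>\<mu>) \<le> ennreal v * emeasure \<mu> S"
    and "0 \<le> b" "0 \<le> v"
  shows "ennreal (exp (- b * v)) * emeasure \<mu> S \<le> (\<integral>\<^sup>+y\<in>S. ennreal (exp (- b * f y)) \<partial>\<mu>)"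
proof -
  let ?c = "exp (- b * v)" and ?a = "emeasure \<mu> S"
  have [measurable]: "S \<in> sets \<mu>" "f \<in> borel_measurable \<mu>"
    by fact+
  have fin: "ennreal (?c * (b * v)) * ?a \<noteq> top"
    using S(2) by (simp add: ennreal_mult_eq_top_iff)
  have "ennreal ?c * ?a + ennreal (?c * (b * v)) * ?a = ennreal (?c * (1 + b * v)) * ?a"
    using assms(6,7) by (simp add: distrib_left distrib_right)
  also have "\<dots> = (\<integral>\<^sup>+y\<in>S. ennreal (?c * (1 + b * v)) \<partial>\<mu>)"
    by (simp add: nn_integral_cmult_indicator)
  also have "\<dots> \<le> (\<integral>\<^sup>+y. ennreal (exp (- b * f y)) * indicator S y
                     + ennreal (?c * b) * (ennreal (f y) * indicator S y) \<partial>\<mu>)"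
  proof (intro nn_integral_mono)
    fix y
    have "ennreal (?c * (1 + b * v)) \<le> ennreal (exp (- b * f y) + ?c * b * f y)"
      using exp_tangent_le[of b v "f y"] by (intro ennreal_leI) (simp add: mult.assoc)
    also have "\<dots> = ennreal (exp (- b * f y)) + ennreal (?c * b) * ennreal (f y)"
      using assms(4,6) by (simp add: ennreal_mult)
    finally show "ennreal (?c * (1 + b * v)) * indicator S y
        \<le> ennreal (exp (- b * f y)) * indicator S y + ennreal (?c * b) * (ennreal (f y) * indicator S y)"
      by (simp split: split_indicator)
  qed
  also have "\<dots> = (\<integral>\<^sup>+y\<in>S. ennreal (exp (- b * f y)) \<partial>\<mu>) + ennreal (?c * b) * (\<integral>\<^sup>+y\<in>S. ennreal (f y) \<partial>\<mu>)"
    by (simp add: nn_integral_add nn_integral_cmult)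
  also have "\<dots> \<le> (\<integral>\<^sup>+y\<in>S. ennreal (exp (- b * f y)) \<partial>\<mu>) + ennreal (?c * b) * (ennreal v * ?a)"
    using var by (intro add_left_mono mult_left_mono) auto
  also have "ennreal (?c * b) * (ennreal v * ?a) = ennreal (?c * (b * v)) * ?a"
    using assms(6,7) by (simp add: ennreal_mult mult.assoc)
  finally show ?thesis
    using fin by (simp add: ennreal_add_left_cancel_le add.commute[of _ "ennreal (?c * (b * v)) * ?a"])
qed

text \<open>
  A potential at the node \<open>p\<close> is controlled by its average over the cell \<open>S\<close>, although the cell may be
  unbounded: the second moment bound keeps enough mass of \<open>S\<close> close to \<open>p\<close>. Quantitatively,
  \<open>(norm (y - z))\<^sup>2 \<le> 2 * (norm (y - p))\<^sup>2 + 2 * (norm (p - z))\<^sup>2\<close> bounds the potential at \<open>p\<close>, damped by a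
  Gaussian in \<open>y - p\<close>, by the potential at \<open>y\<close> with half the exponent, and by Jensen's inequality the
  damping costs on average only the factor \<open>exp (b * e\<^sup>2)\<close>.
\<close>

lemma gauss_potential_le_cell_average:
  fixes \<mu> \<kappa> :: "'a::euclidean_space measure"
  assumes \<kappa>: "sigma_finite_measure \<kappa>" "sets \<kappa> = sets borel" and \<mu>: "sets \<mu> = sets borel"
    and S: "S \<in> sets borel" "emeasure \<mu> S < \<infinity>"
    and var: "(\<integral>\<^sup>+y\<in>S. ennreal ((norm (y - p))\<^sup>2) \<partial>\<mu>) \<le> ennreal (e\<^sup>2) * emeasure \<mu> S"
    and b: "0 \<le> b"
  shows "emeasure \<mu> S * gauss_potential \<kappa> b (\<lambda>_. 1) p
      \<le> ennreal (exp (b * e\<^sup>2)) * (\<integral>\<^sup>+y\<in>S. gauss_potential \<kappa> (b / 2) (\<lambda>_. 1) y \<partial>\<mu>)"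
proof -
  let ?K = "gauss_potential \<kappa> b (\<lambda>_. 1) p"
  have [measurable]: "gauss_potential \<kappa> (b / 2) (\<lambda>_. 1) \<in> borel_measurable borel"
    using \<kappa> by (rule borel_measurable_gauss_potential) simp
  note [measurable_cong] = \<mu> \<kappa>(2)
  note [measurable] = S(1)
  have pt: "?K * ennreal (exp (- b * (norm (y - p))\<^sup>2)) \<le> gauss_potential \<kappa> (b / 2) (\<lambda>_. 1) y" for y
  proof -
    have "?K * ennreal (exp (- b * (norm (y - p))\<^sup>2))
        = (\<integral>\<^sup>+z. ennreal (1 * exp (- b * (norm (p - z))\<^sup>2)) * ennreal (exp (- b * (norm (y - p))\<^sup>2)) \<partial>\<kappa>)"
      unfolding gauss_potential_def by (rule nn_integral_multc[symmetric]) simp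
    also have "\<dots> \<le> gauss_potential \<kappa> (b / 2) (\<lambda>_. 1) y"
      unfolding gauss_potential_def
    proof (rule nn_integral_mono)
      fix z
      have "(norm (y - z))\<^sup>2 \<le> (norm (y - p) + norm (p - z))\<^sup>2"
        using norm_triangle_ineq[of "y - p" "p - z"] by (intro power_mono) auto
      also have "\<dots> \<le> 2 * (norm (y - p))\<^sup>2 + 2 * (norm (p - z))\<^sup>2"
        using zero_le_power2[of "norm (y - p) - norm (p - z)"] by (simp add: power2_eq_square algebra_simps)
      finally have "b / 2 * (norm (y - z))\<^sup>2 \<le> b / 2 * (2 * (norm (y - p))\<^sup>2 + 2 * (norm (p - z))\<^sup>2)"
        using b by (intro mult_left_mono) auto
      then have "exp (- b * (norm (p - z))\<^sup>2) * exp (- b * (norm (y - p))\<^sup>2) \<le> exp (- (b / 2) * (norm (y - z))\<^sup>2)"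
        unfolding exp_add[symmetric] exp_le_cancel_iff by (simp add: algebra_simps)
      then show "ennreal (1 * exp (- b * (norm (p - z))\<^sup>2)) * ennreal (exp (- b * (norm (y - p))\<^sup>2))
          \<le> ennreal (1 * exp (- (b / 2) * (norm (y - z))\<^sup>2))"
        by (simp add: ennreal_leI flip: ennreal_mult)
    qed
    finally show ?thesis .
  qed
  have "emeasure \<mu> S * ?K = ennreal (exp (b * e\<^sup>2)) * (?K * (ennreal (exp (- b * e\<^sup>2)) * emeasure \<mu> S))"
  proof -
    have "ennreal (exp (b * e\<^sup>2)) * ennreal (exp (- b * e\<^sup>2)) = 1"
      by (simp flip: ennreal_mult exp_add)
    then show ?thesis
      by (metis (no_types, lifting) mult.assoc mult.commute mult.left_neutral)
  qed
  also have "\<dots> \<le> ennreal (exp (b * e\<^sup>2)) * (?K * (\<integral>\<^sup>+y\<in>S. ennreal (exp (- b * (norm (y - p))\<^sup>2)) \<partial>\<mu>))"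
    using S \<mu> var b by (intro mult_left_mono exp_neg_variance_le) auto
  also have "?K * (\<integral>\<^sup>+y\<in>S. ennreal (exp (- b * (norm (y - p))\<^sup>2)) \<partial>\<mu>)
      = (\<integral>\<^sup>+y\<in>S. ?K * ennreal (exp (- b * (norm (y - p))\<^sup>2)) \<partial>\<mu>)"
    by (subst nn_integral_cmult[symmetric]) (auto simp: mult.assoc)
  also have "\<dots> \<le> (\<integral>\<^sup>+y\<in>S. gauss_potential \<kappa> (b / 2) (\<lambda>_. 1) y \<partial>\<mu>)"
    using pt by (intro nn_integral_mono mult_right_mono) auto
  finally show ?thesis
    by (simp add: mult_left_mono)
qed

text \<open>
  Instead of the Cauchy-Schwarz inequality, its optimised linear form
  \<open>t \<le> t\<^sup>2 / (2 * e) + e / 2\<close> is integrated over the cell.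
\<close>

lemma first_moment_le:
  fixes \<mu> :: "'a::euclidean_space measure"
  assumes \<mu>: "sets \<mu> = sets borel" and S: "S \<in> sets borel" "emeasure \<mu> S < \<infinity>"
    and var: "(\<integral>\<^sup>+y\<in>S. ennreal ((norm (y - p))\<^sup>2) \<partial>\<mu>) \<le> ennreal (e\<^sup>2) * emeasure \<mu> S"
    and e: "0 < e"
  shows "(\<integral>\<^sup>+y\<in>S. ennreal (norm (y - p)) \<partial>\<mu>) \<le> ennreal e * emeasure \<mu> S"
proof -
  note [measurable_cong] = \<mu>
  note [measurable] = S(1)
  have "(\<integral>\<^sup>+y\<in>S. ennreal (norm (y - p)) \<partial>\<mu>)
      \<le> (\<integral>\<^sup>+y. ennreal (1 / (2 * e)) * (ennreal ((norm (y - p))\<^sup>2) * indicator S y) + ennreal (e / 2) * indicator S y \<partial>\<mu>)"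
  proof (rule nn_integral_mono)
    fix y
    have "norm (y - p) \<le> 1 / (2 * e) * (norm (y - p))\<^sup>2 + e / 2"
      using zero_le_power2[of "norm (y - p) - e"] e by (simp add: field_simps power2_eq_square)
    then have "ennreal (norm (y - p)) \<le> ennreal (1 / (2 * e) * (norm (y - p))\<^sup>2 + e / 2)"
      by (rule ennreal_leI)
    also have "\<dots> = ennreal (1 / (2 * e)) * ennreal ((norm (y - p))\<^sup>2) + ennreal (e / 2)"
      using e by (simp del: times_divide_eq_left flip: ennreal_mult ennreal_plus)
    finally show "ennreal (norm (y - p)) * indicator S y
        \<le> ennreal (1 / (2 * e)) * (ennreal ((norm (y - p))\<^sup>2) * indicator S y) + ennreal (e / 2) * indicator S y"
      by (simp split: split_indicator)
  qed
  also have "\<dots> = ennreal (1 / (2 * e)) * (\<integral>\<^sup>+y\<in>S. ennreal ((norm (y - p))\<^sup>2) \<partial>\<mu>) + ennreal (e / 2) * emeasure \<mu> S"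
    using \<mu> S(1) by (subst nn_integral_add) (auto simp: nn_integral_cmult nn_integral_cmult_indicator)
  also have "\<dots> \<le> ennreal (1 / (2 * e)) * (ennreal (e\<^sup>2) * emeasure \<mu> S) + ennreal (e / 2) * emeasure \<mu> S"
    using var by (intro add_right_mono mult_left_mono) auto
  also have "\<dots> = (ennreal (1 / (2 * e)) * ennreal (e\<^sup>2) + ennreal (e / 2)) * emeasure \<mu> S"
    by (simp add: distrib_right mult.assoc)
  also have "ennreal (1 / (2 * e)) * ennreal (e\<^sup>2) + ennreal (e / 2) = ennreal e"
    using e by (simp add: power2_eq_square flip: ennreal_mult ennreal_plus)
  finally show ?thesis .
qed

text \<open>
  The increment of \<open>g\<close> and the increment of the Gaussian are estimated separately. Both are bounded by
  the distance \<open>norm (y - p)\<close> times a Gaussian centred at \<open>p\<close>. Eliminating the Gaussian centred at \<open>y\<close>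
  is the purpose of the assumption \<open>near\<close>: beyond the scale \<open>e\<close>, the point \<open>z\<close> cannot be
  much closer to \<open>y\<close> than to \<open>p\<close>, whence the exponent \<open>b / (2 * c\<^sup>2)\<close>. The factor \<open>sqrt b \<ge> 1\<close> absorbs the Lipschitz part as well.
\<close>

lemma weighted_gaussian_diff_le:
  fixes y p z :: "'a::euclidean_space"
  assumes near: "(norm (p - z))\<^sup>2 \<le> c\<^sup>2 * (e\<^sup>2 + (norm (y - z))\<^sup>2)"
    and g: "0 \<le> g y" "g y \<le> 1" "\<bar>g p - g y\<bar> \<le> L * norm (y - p)" "0 \<le> L"
    and c: "1 \<le> c" and b: "1 \<le> b" "b * e\<^sup>2 \<le> B"
  shows "\<bar>g p * exp (- b * (norm (p - z))\<^sup>2) - g y * exp (- b * (norm (y - z))\<^sup>2)\<bar>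
      \<le> sqrt b * norm (y - p) * (L + 1 + exp B) * exp (- (b / (2 * c\<^sup>2)) * (norm (p - z))\<^sup>2)"
proof -
  let ?v = "exp (- (b / (2 * c\<^sup>2)) * (norm (p - z))\<^sup>2)"
  have c2: "1 \<le> c\<^sup>2"
    using c by simp
  have half: "exp (- (b / 2) * (norm (p - z))\<^sup>2) \<le> ?v"
  proof -
    have "b / (2 * c\<^sup>2) \<le> b / 2"
      using c2 b by (intro divide_left_mono) auto
    then have "b / (2 * c\<^sup>2) * (norm (p - z))\<^sup>2 \<le> b / 2 * (norm (p - z))\<^sup>2"
      by (rule mult_right_mono) simp
    then show ?thesis
      by simp
  qed
  have full: "exp (- b * (norm (p - z))\<^sup>2) \<le> ?v"
  proof -
    have "b / (2 * c\<^sup>2) \<le> b / 1"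
      using c2 b by (intro divide_left_mono) auto
    then have "b / (2 * c\<^sup>2) * (norm (p - z))\<^sup>2 \<le> b / 1 * (norm (p - z))\<^sup>2"
      by (rule mult_right_mono) simp
    then show ?thesis
      by simp
  qed
  have other: "exp (- (b / 2) * (norm (y - z))\<^sup>2) \<le> exp B * ?v"
  proof -
    have "(norm (p - z))\<^sup>2 / c\<^sup>2 \<le> e\<^sup>2 + (norm (y - z))\<^sup>2"
      using near c2 by (subst pos_divide_le_eq) (auto simp: mult.commute)
    then have "b / 2 * ((norm (p - z))\<^sup>2 / c\<^sup>2) \<le> b / 2 * (e\<^sup>2 + (norm (y - z))\<^sup>2)"
      using b by (intro mult_left_mono) auto
    moreover have "b / 2 * e\<^sup>2 \<le> b * e\<^sup>2"
      using b by (simp add: mult_right_mono)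
    ultimately have "- (b / 2) * (norm (y - z))\<^sup>2 \<le> B + (- (b / (2 * c\<^sup>2)) * (norm (p - z))\<^sup>2)"
      using b(2) by (simp add: distrib_left)
    then show ?thesis
      by (simp flip: exp_add)
  qed
  have "\<bar>g p * exp (- b * (norm (p - z))\<^sup>2) - g y * exp (- b * (norm (y - z))\<^sup>2)\<bar>
      = \<bar>(g p - g y) * exp (- b * (norm (p - z))\<^sup>2)
          + g y * (exp (- b * (norm (p - z))\<^sup>2) - exp (- b * (norm (y - z))\<^sup>2))\<bar>"
    by (simp add: algebra_simps)
  also have "\<dots> \<le> \<bar>g p - g y\<bar> * exp (- b * (norm (p - z))\<^sup>2)
          + g y * \<bar>exp (- b * (norm (p - z))\<^sup>2) - exp (- b * (norm (y - z))\<^sup>2)\<bar>"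
    using g(1) by (intro order_trans[OF abs_triangle_ineq]) (simp add: abs_mult)
  also have "\<dots> \<le> sqrt b * norm (y - p) * L * ?v + sqrt b * norm (y - p) * (1 + exp B) * ?v"
  proof (rule add_mono)
    have "L * norm (y - p) \<le> sqrt b * (L * norm (y - p))"
      using mult_right_mono[of 1 "sqrt b" "L * norm (y - p)"] b g(4) by simp
    then have "\<bar>g p - g y\<bar> \<le> sqrt b * norm (y - p) * L"
      using g(3) by (simp add: ac_simps)
    then show "\<bar>g p - g y\<bar> * exp (- b * (norm (p - z))\<^sup>2) \<le> sqrt b * norm (y - p) * L * ?v"
      using full by (intro mult_mono) (auto intro: order_trans[OF abs_ge_zero])
    have "\<bar>norm (p - z) - norm (y - z)\<bar> \<le> norm (y - p)"
      using norm_triangle_ineq3[of "p - z" "y - z"] by (simp add: norm_minus_commute)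
    then have "\<bar>exp (- b * (norm (p - z))\<^sup>2) - exp (- b * (norm (y - z))\<^sup>2)\<bar>
        \<le> sqrt b * norm (y - p) * (?v + exp B * ?v)"
      using half other b
      by (intro order_trans[OF gaussian_diff_le] mult_mono add_mono) auto
    then have "g y * \<bar>exp (- b * (norm (p - z))\<^sup>2) - exp (- b * (norm (y - z))\<^sup>2)\<bar>
        \<le> 1 * (sqrt b * norm (y - p) * (?v + exp B * ?v))"
      using g(1,2) by (intro mult_mono) auto
    then show "g y * \<bar>exp (- b * (norm (p - z))\<^sup>2) - exp (- b * (norm (y - z))\<^sup>2)\<bar>
        \<le> sqrt b * norm (y - p) * (1 + exp B) * ?v"
      by (simp add: algebra_simps)
  qed
  also have "\<dots> = sqrt b * norm (y - p) * (L + 1 + exp B) * ?v"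
    by (simp add: algebra_simps)
  finally show ?thesis .
qed

text \<open>
  The pointwise estimate integrated in \<open>z\<close>. Because the error depends on \<open>y\<close> only through
  \<open>norm (y - p)\<close>, integrating it over a cell will only require the first moment.
\<close>

lemma gauss_potential_diff_le:
  fixes \<kappa> :: "'a::euclidean_space measure"
  assumes \<kappa>: "sets \<kappa> = sets borel" "AE z in \<kappa>. z \<in> E"
    and near: "\<And>z. z \<in> E \<Longrightarrow> (norm (p - z))\<^sup>2 \<le> c\<^sup>2 * (e\<^sup>2 + (norm (y - z))\<^sup>2)"
    and g: "g \<in> borel_measurable borel" "\<And>x. 0 \<le> g x" "\<And>x. g x \<le> 1"
      "\<And>x x'. \<bar>g x - g x'\<bar> \<le> L * dist x x'" "0 \<le> L"
    and c: "1 \<le> c" and b: "1 \<le> b" "b * e\<^sup>2 \<le> B"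
  defines "D \<equiv> ennreal (sqrt b * (L + 1 + exp B)) * gauss_potential \<kappa> (b / (2 * c\<^sup>2)) (\<lambda>_. 1) p * ennreal (norm (y - p))"
  shows "gauss_potential \<kappa> b g p \<le> gauss_potential \<kappa> b g y + D"
    and "gauss_potential \<kappa> b g y \<le> gauss_potential \<kappa> b g p + D"
proof -
  note [measurable_cong] = \<kappa>(1)
  have [measurable]: "(\<lambda>z. g (u, z)) \<in> borel_measurable borel" for u
    using g(1) by measurable
  define r where "r z = sqrt b * norm (y - p) * (L + 1 + exp B) * exp (- (b / (2 * c\<^sup>2)) * (norm (p - z))\<^sup>2)" for z
  have r0: "0 \<le> r z" for z
    unfolding r_def using b g(5) by (intro mult_nonneg_nonneg add_nonneg_nonneg) auto
  have [measurable]: "r \<in> borel_measurable borel"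
    unfolding r_def[abs_def] by measurable
  have "(\<integral>\<^sup>+z. ennreal (r z) \<partial>\<kappa>)
      = (\<integral>\<^sup>+z. ennreal (sqrt b * (L + 1 + exp B) * norm (y - p)) * ennreal (1 * exp (- (b / (2 * c\<^sup>2)) * (norm (p - z))\<^sup>2)) \<partial>\<kappa>)"
    unfolding r_def using b g(5)
    by (intro nn_integral_cong) (simp add: ac_simps flip: ennreal_mult)
  also have "\<dots> = ennreal (sqrt b * (L + 1 + exp B) * norm (y - p)) * gauss_potential \<kappa> (b / (2 * c\<^sup>2)) (\<lambda>_. 1) p"
    unfolding gauss_potential_def by (rule nn_integral_cmult) simp
  also have "\<dots> = D"
    unfolding D_def using b g(5) by (simp add: ennreal_mult ac_simps)
  finally have D: "(\<integral>\<^sup>+z. ennreal (r z) \<partial>\<kappa>) = D" .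
  let ?f = "\<lambda>u z. g (u, z) * exp (- b * (norm (u - z))\<^sup>2)"
  have diff: "\<bar>?f p z - ?f y z\<bar> \<le> r z" if "z \<in> E" for z
    unfolding r_def using near[OF that] g(2,3,5) c b g(4)[of "(p, z)" "(y, z)"]
    by (intro weighted_gaussian_diff_le[where g = "\<lambda>u. g (u, z)"]) (auto simp: dist_Pair_Pair dist_norm norm_minus_commute)
  have le: "gauss_potential \<kappa> b g u \<le> gauss_potential \<kappa> b g w + D"
    if "\<And>z. z \<in> E \<Longrightarrow> ?f u z \<le> ?f w z + r z" for u w
  proof -
    have "gauss_potential \<kappa> b g u \<le> (\<integral>\<^sup>+z. ennreal (?f w z) + ennreal (r z) \<partial>\<kappa>)"
      unfolding gauss_potential_def
    proof (rule nn_integral_mono_AE, use \<kappa>(2) in eventually_elim)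
      case (elim z)
      then show ?case
        using that[of z] g(2) r0 by (simp add: ennreal_leI flip: ennreal_plus)
    qed
    also have "\<dots> = gauss_potential \<kappa> b g w + D"
      unfolding gauss_potential_def D[symmetric] by (rule nn_integral_add) measurable
    finally show ?thesis .
  qed
  show "gauss_potential \<kappa> b g p \<le> gauss_potential \<kappa> b g y + D"
    using diff by (intro le) (smt (verit))
  show "gauss_potential \<kappa> b g y \<le> gauss_potential \<kappa> b g p + D"
    using diff by (intro le) (smt (verit))
qed

section \<open>Integration against atomic and thermalized measures\<close>

lemma nn_integral_countable_partition:
  fixes \<mu> :: "'a::topological_space measure"
  assumes \<mu>: "sets \<mu> = sets borel" and P: "countable P"
    and A: "\<And>p. p \<in> P \<Longrightarrow> A p \<in> sets borel" "disjoint_family_on A P" "(\<Union>p\<in>P. A p) = UNIV"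
    and f: "f \<in> borel_measurable borel"
  shows "(\<integral>\<^sup>+y. f y \<partial>\<mu>) = (\<integral>\<^sup>+p. (\<integral>\<^sup>+y\<in>A p. f y \<partial>\<mu>) \<partial>count_space P)"
proof -
  note [measurable_cong] = \<mu>
  note [measurable] = f A(1)
  have "f y = (\<integral>\<^sup>+p. f y * indicator (A p) y \<partial>count_space P)" for y
  proof -
    obtain p where p: "p \<in> P" "y \<in> A p"
      using A(3) by blast
    have "y \<notin> A q" if "q \<in> P" "q \<noteq> p" for q
      using A(2) p that unfolding disjoint_family_on_def by blast
    then have "(\<integral>\<^sup>+q. f y * indicator (A q) y \<partial>count_space P) = (\<integral>\<^sup>+q. f y * indicator {p} q \<partial>count_space P)"
      using p by (intro nn_integral_cong) (auto split: split_indicator)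
    also have "\<dots> = f y"
      using p by (simp add: nn_integral_cmult_indicator)
    finally show ?thesis ..
  qed
  then have "(\<integral>\<^sup>+y. f y \<partial>\<mu>) = (\<integral>\<^sup>+y. (\<integral>\<^sup>+p. f y * indicator (A p) y \<partial>count_space P) \<partial>\<mu>)"
    by simp
  also have "\<dots> = (\<integral>\<^sup>+p. (\<integral>\<^sup>+y\<in>A p. f y \<partial>\<mu>) \<partial>count_space P)"
    using P by (rule nn_integral_count_space_nn_integral) measurable
  finally show ?thesis .
qed

lemma sets_atomic_measure: "sets (atomic_measure P m) = sets borel"
  unfolding atomic_measure_def by simp

lemma nn_integral_atomic_measure:
  assumes "f \<in> borel_measurable borel"
  shows "(\<integral>\<^sup>+y. f y \<partial>atomic_measure P m) = (\<integral>\<^sup>+p. ennreal (m p) * f p \<partial>count_space P)"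
  unfolding atomic_measure_def point_measure_def using assms
  by (subst nn_integral_distr) (auto simp: nn_integral_density)

lemma sets_thermalize_pair:
  fixes \<nu> \<kappa> :: "'a::euclidean_space measure"
  assumes "sets \<nu> = sets borel" "sets \<kappa> = sets borel"
  shows "sets (thermalize b (\<nu> \<Otimes>\<^sub>M \<kappa>)) = sets borel"
  unfolding thermalize_def sets_density borel_prod[symmetric] using assms by (rule sets_pair_measure_cong)

lemma nn_integral_thermalize_pair:
  fixes \<nu> \<kappa> :: "'a::euclidean_space measure"
  assumes \<nu>: "sets \<nu> = sets borel" and \<kappa>: "sigma_finite_measure \<kappa>" "sets \<kappa> = sets borel"
    and g: "g \<in> borel_measurable borel" "\<And>x. 0 \<le> g x"
  shows "(\<integral>\<^sup>+x. ennreal (g x) \<partial>thermalize b (\<nu> \<Otimes>\<^sub>M \<kappa>))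
      = ennreal (1 / gauss_mass TYPE('a) b) * (\<integral>\<^sup>+y. gauss_potential \<kappa> b g y \<partial>\<nu>)"
proof -
  interpret sigma_finite_measure \<kappa> by fact
  let ?q = "1 / gauss_mass TYPE('a) b"
  have q: "0 \<le> ?q"
    by (simp add: gauss_mass_nonneg)
  have pair: "sets (\<nu> \<Otimes>\<^sub>M \<kappa>) = sets (borel \<Otimes>\<^sub>M borel)"
    using \<nu> \<kappa>(2) by (rule sets_pair_measure_cong)
  note [measurable_cong] = pair \<nu> \<kappa>(2)
  have [measurable]: "g \<in> borel_measurable (borel \<Otimes>\<^sub>M borel)"
    using g(1) by (simp add: borel_prod)
  have w: "thermal_weight b (x :: 'a \<times> 'a) = ?q * exp (- b * (norm (fst x - snd x))\<^sup>2)" for x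
    unfolding thermal_weight_def by (simp add: split_beta')
  have [measurable]: "gauss_potential \<kappa> b g \<in> borel_measurable borel"
    using \<kappa> g(1) by (rule borel_measurable_gauss_potential)
  have "(\<integral>\<^sup>+x. ennreal (g x) \<partial>thermalize b (\<nu> \<Otimes>\<^sub>M \<kappa>))
      = (\<integral>\<^sup>+x. ennreal (thermal_weight b x) * ennreal (g x) \<partial>(\<nu> \<Otimes>\<^sub>M \<kappa>))"
    unfolding thermalize_def by (rule nn_integral_density) (unfold w, measurable)
  also have "\<dots> = (\<integral>\<^sup>+x. ennreal ?q * ennreal (g x * exp (- b * (norm (fst x - snd x))\<^sup>2)) \<partial>(\<nu> \<Otimes>\<^sub>M \<kappa>))"
    using q g(2) unfolding w by (intro nn_integral_cong) (simp add: ac_simps flip: ennreal_mult)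
  also have "\<dots> = ennreal ?q * (\<integral>\<^sup>+x. ennreal (g x * exp (- b * (norm (fst x - snd x))\<^sup>2)) \<partial>(\<nu> \<Otimes>\<^sub>M \<kappa>))"
    by (rule nn_integral_cmult) measurable
  also have "(\<integral>\<^sup>+x. ennreal (g x * exp (- b * (norm (fst x - snd x))\<^sup>2)) \<partial>(\<nu> \<Otimes>\<^sub>M \<kappa>))
      = (\<integral>\<^sup>+y. gauss_potential \<kappa> b g y \<partial>\<nu>)"
    unfolding gauss_potential_def by (subst nn_integral_fst[symmetric]) auto
  finally show ?thesis .
qed

section \<open>Concentrating the mass of one cell at its node\<close>

text \<open>
  The cell mass, times the potential at \<open>p\<close>, differs from the integral of the potential over \<open>S\<close> by a
  multiple of the first moment of \<open>S\<close>, hence of \<open>e\<close> times its mass; replacing the cell mass by the weight \<open>w\<close>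
  costs the relative error \<open>d\<close>. Both errors carry a potential at \<open>p\<close>, which is then turned back into a
  cell average, so that the errors of different cells can be added up.
\<close>

lemma cell_error_le:
  fixes \<mu> \<kappa> :: "'a::euclidean_space measure"
  assumes \<mu>: "sets \<mu> = sets borel" and \<kappa>: "sigma_finite_measure \<kappa>" "sets \<kappa> = sets borel" "AE z in \<kappa>. z \<in> E"
    and S: "S \<in> sets borel" "emeasure \<mu> S < \<infinity>"
    and near: "\<And>y z. y \<in> S \<Longrightarrow> z \<in> E \<Longrightarrow> (norm (p - z))\<^sup>2 \<le> c\<^sup>2 * (e\<^sup>2 + (norm (y - z))\<^sup>2)"
    and var: "(\<integral>\<^sup>+y\<in>S. ennreal ((norm (y - p))\<^sup>2) \<partial>\<mu>) \<le> ennreal (e\<^sup>2) * emeasure \<mu> S"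
    and w: "0 \<le> w" "\<bar>w - measure \<mu> S\<bar> \<le> d * measure \<mu> S" "0 \<le> d"
    and g: "g \<in> borel_measurable borel" "\<And>x. 0 \<le> g x" "\<And>x. g x \<le> 1"
      "\<And>x x'. \<bar>g x - g x'\<bar> \<le> L * dist x x'" "0 \<le> L"
    and c: "1 \<le> c" and b: "1 \<le> b" "b * e\<^sup>2 \<le> B" and e: "0 < e"
  defines "R \<equiv> ennreal (exp B * (L + 1 + exp B) * (d + sqrt b * e))
      * (\<integral>\<^sup>+y\<in>S. gauss_potential \<kappa> (b / (4 * c\<^sup>2)) (\<lambda>_. 1) y \<partial>\<mu>)"
  shows "ennreal w * gauss_potential \<kappa> b g p \<le> (\<integral>\<^sup>+y\<in>S. gauss_potential \<kappa> b g y \<partial>\<mu>) + R"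
    and "(\<integral>\<^sup>+y\<in>S. gauss_potential \<kappa> b g y \<partial>\<mu>) \<le> ennreal w * gauss_potential \<kappa> b g p + R"
proof -
  note [measurable_cong] = \<mu>
  note [measurable] = S(1)
  have [measurable]: "gauss_potential \<kappa> b g \<in> borel_measurable borel"
    using \<kappa>(1,2) g(1) by (rule borel_measurable_gauss_potential)
  define H where "H = gauss_potential \<kappa> b g"
  define J where "J = L + 1 + exp B"
  define V where "V = gauss_potential \<kappa> (b / (2 * c\<^sup>2)) (\<lambda>_. 1) p"
  define a where "a = emeasure \<mu> S"
  define s where "s = ennreal (sqrt b * J)"
  have [measurable]: "H \<in> borel_measurable borel"
    unfolding H_def by measurable
  have J: "1 \<le> J"
    unfolding J_def using g(5) by simp
  have a: "a = ennreal (measure \<mu> S)"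
    unfolding a_def using S(2) by (simp add: emeasure_eq_ennreal_measure)
  have c2: "1 \<le> c\<^sup>2"
    using c by simp
  \<comment> \<open>\<open>V\<close> dominates the potential at the node, so it serves as common factor of both errors.\<close>
  have HV: "H p \<le> V"
  proof -
    have "b / (2 * c\<^sup>2) \<le> b / 1"
      using c2 b by (intro divide_left_mono) auto
    then show ?thesis
      unfolding H_def V_def using g(3) by (intro gauss_potential_mono) auto
  qed
  have spread: "(\<integral>\<^sup>+y\<in>S. s * V * ennreal (norm (y - p)) \<partial>\<mu>) \<le> s * ennreal e * (a * V)"
  proof -
    have "(\<integral>\<^sup>+y\<in>S. s * V * ennreal (norm (y - p)) \<partial>\<mu>) = s * V * (\<integral>\<^sup>+y\<in>S. ennreal (norm (y - p)) \<partial>\<mu>)"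
      by (subst nn_integral_cmult[symmetric]) (auto simp: mult.assoc)
    also have "\<dots> \<le> s * V * (ennreal e * a)"
      unfolding a_def using first_moment_le[OF \<mu> S var e] by (intro mult_left_mono) auto
    finally show ?thesis
      by (simp add: ac_simps)
  qed
  have pt: "H p \<le> H y + s * V * ennreal (norm (y - p))" "H y \<le> H p + s * V * ennreal (norm (y - p))" if "y \<in> S" for y
    unfolding H_def s_def V_def J_def using near[OF that]
    by (intro gauss_potential_diff_le[OF \<kappa>(2,3) _ g c b]; assumption)+
  have const: "a * H p = (\<integral>\<^sup>+y\<in>S. H p \<partial>\<mu>)"
    unfolding a_def using S(1) \<mu> by (simp add: nn_integral_cmult_indicator mult.commute)
  have up: "a * H p \<le> (\<integral>\<^sup>+y\<in>S. H y \<partial>\<mu>) + s * ennreal e * (a * V)"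
  proof -
    have "a * H p \<le> (\<integral>\<^sup>+y. H y * indicator S y + s * V * ennreal (norm (y - p)) * indicator S y \<partial>\<mu>)"
      unfolding const using pt(1) by (intro nn_integral_mono) (simp split: split_indicator)
    also have "\<dots> = (\<integral>\<^sup>+y\<in>S. H y \<partial>\<mu>) + (\<integral>\<^sup>+y\<in>S. s * V * ennreal (norm (y - p)) \<partial>\<mu>)"
      by (rule nn_integral_add) measurable
    finally show ?thesis
      using spread by (meson add_left_mono order_trans)
  qed
  have down: "(\<integral>\<^sup>+y\<in>S. H y \<partial>\<mu>) \<le> a * H p + s * ennreal e * (a * V)"
  proof -
    have "(\<integral>\<^sup>+y\<in>S. H y \<partial>\<mu>) \<le> (\<integral>\<^sup>+y. H p * indicator S y + s * V * ennreal (norm (y - p)) * indicator S y \<partial>\<mu>)"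
      using pt(2) by (intro nn_integral_mono) (simp split: split_indicator)
    also have "\<dots> = a * H p + (\<integral>\<^sup>+y\<in>S. s * V * ennreal (norm (y - p)) \<partial>\<mu>)"
      unfolding const by (rule nn_integral_add) measurable
    finally show ?thesis
      using spread by (meson add_left_mono order_trans)
  qed
  have R: "ennreal d * (a * V) + s * ennreal e * (a * V) \<le> R"
  proof -
    have "ennreal d + s * ennreal e = ennreal (d + sqrt b * J * e)"
      unfolding s_def using w(3) b J e by (simp flip: ennreal_mult ennreal_plus)
    \<comment> \<open>\<open>J \<ge> 1\<close> lets the relative error \<open>d\<close> share the constant of the displacement error.\<close>
    also have "\<dots> \<le> ennreal (J * (d + sqrt b * e))"
      using mult_right_mono[OF J w(3)] by (intro ennreal_leI) (simp add: algebra_simps)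
    finally have coeff: "ennreal d * (a * V) + s * ennreal e * (a * V) \<le> ennreal (J * (d + sqrt b * e)) * (a * V)"
      by (simp add: distrib_right[symmetric] mult_right_mono)
    have "a * V \<le> ennreal (exp (b / (2 * c\<^sup>2) * e\<^sup>2)) * (\<integral>\<^sup>+y\<in>S. gauss_potential \<kappa> (b / (2 * c\<^sup>2) / 2) (\<lambda>_. 1) y \<partial>\<mu>)"
      unfolding a_def V_def using b
      by (intro gauss_potential_le_cell_average[OF \<kappa>(1,2) \<mu> S var]) simp
    also have "\<dots> \<le> ennreal (exp B) * (\<integral>\<^sup>+y\<in>S. gauss_potential \<kappa> (b / (4 * c\<^sup>2)) (\<lambda>_. 1) y \<partial>\<mu>)"
    proof (intro mult_mono ennreal_leI)
      have "b / (2 * c\<^sup>2) \<le> b / 1"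
        using c2 b by (intro divide_left_mono) auto
      then have "b / (2 * c\<^sup>2) * e\<^sup>2 \<le> b / 1 * e\<^sup>2"
        by (rule mult_right_mono) simp
      then show "exp (b / (2 * c\<^sup>2) * e\<^sup>2) \<le> exp B"
        using b(2) by simp
    qed (auto simp: mult.commute)
    finally have "ennreal (J * (d + sqrt b * e)) * (a * V) \<le> ennreal (J * (d + sqrt b * e))
        * (ennreal (exp B) * (\<integral>\<^sup>+y\<in>S. gauss_potential \<kappa> (b / (4 * c\<^sup>2)) (\<lambda>_. 1) y \<partial>\<mu>))"
      by (rule mult_left_mono) simp
    also have "\<dots> = R"
    proof -
      have "ennreal (exp B * J * (d + sqrt b * e)) = ennreal (J * (d + sqrt b * e)) * ennreal (exp B)"
        using J w(3) b e by (subst ennreal_mult[symmetric]) (auto simp: ac_simps)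
      then show ?thesis
        unfolding R_def J_def[symmetric] by (simp only: mult.assoc)
    qed
    finally show ?thesis
      using coeff by (rule order_trans[rotated])
  qed
  have dH: "ennreal d * (a * H p) \<le> ennreal d * (a * V)"
    using HV by (intro mult_left_mono) auto
  have "w \<le> measure \<mu> S + d * measure \<mu> S" "measure \<mu> S \<le> w + d * measure \<mu> S"
    using w(2) by auto
  then have wa: "ennreal w \<le> a + ennreal d * a" "a \<le> ennreal w + ennreal d * a"
    unfolding a using w by (simp_all add: ennreal_leI flip: ennreal_mult ennreal_plus)
  have "ennreal w * H p \<le> a * H p + ennreal d * (a * H p)"
    using mult_right_mono[OF wa(1), of "H p"] by (simp add: distrib_right mult.assoc)
  also have "\<dots> \<le> (\<integral>\<^sup>+y\<in>S. H y \<partial>\<mu>) + s * ennreal e * (a * V) + ennreal d * (a * V)"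
    using up dH by (rule add_mono)
  also have "\<dots> \<le> (\<integral>\<^sup>+y\<in>S. H y \<partial>\<mu>) + R"
    using add_left_mono[OF R, of "\<integral>\<^sup>+y\<in>S. H y \<partial>\<mu>"] by (simp only: ac_simps)
  finally show "ennreal w * gauss_potential \<kappa> b g p \<le> (\<integral>\<^sup>+y\<in>S. gauss_potential \<kappa> b g y \<partial>\<mu>) + R"
    unfolding H_def .
  have "a * H p \<le> ennreal w * H p + ennreal d * (a * H p)"
    using mult_right_mono[OF wa(2), of "H p"] by (simp add: distrib_right mult.assoc)
  also have "\<dots> \<le> ennreal w * H p + ennreal d * (a * V)"
    using dH by (rule add_left_mono)
  finally have "(\<integral>\<^sup>+y\<in>S. H y \<partial>\<mu>) \<le> ennreal w * H p + ennreal d * (a * V) + s * ennreal e * (a * V)"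
    using down by (meson add_right_mono order_trans)
  also have "\<dots> \<le> ennreal w * H p + R"
    using add_left_mono[OF R, of "ennreal w * H p"] by (simp only: ac_simps)
  finally show "(\<integral>\<^sup>+y\<in>S. gauss_potential \<kappa> b g y \<partial>\<mu>) \<le> ennreal w * gauss_potential \<kappa> b g p + R"
    unfolding H_def .
qed

text \<open>
  Summing the cell estimates over the partition. The cell averages in the errors recombine to a single
  integral against \<open>\<mu>\<close> at the smaller inverse temperature \<open>b / (4 * c\<^sup>2)\<close>: a factor 2 is lost by factoring the
  Gaussians, a factor \<open>c\<^sup>2\<close> by changing their centres, and another 2 by averaging over the cells.
\<close>

lemma quantization_error_le:
  fixes \<mu> \<kappa> :: "'a::euclidean_space measure"
  assumes \<mu>: "sets \<mu> = sets borel" and \<kappa>: "sigma_finite_measure \<kappa>" "sets \<kappa> = sets borel" "AE z in \<kappa>. z \<in> E"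
    and P: "countable P"
    and A: "\<And>p. p \<in> P \<Longrightarrow> A p \<in> sets borel" "disjoint_family_on A P" "(\<Union>p\<in>P. A p) = UNIV"
      "\<And>p. p \<in> P \<Longrightarrow> emeasure \<mu> (A p) < \<infinity>"
    and near: "\<And>p y z. p \<in> P \<Longrightarrow> y \<in> A p \<Longrightarrow> z \<in> E \<Longrightarrow> (norm (p - z))\<^sup>2 \<le> c\<^sup>2 * (e\<^sup>2 + (norm (y - z))\<^sup>2)"
    and var: "\<And>p. p \<in> P \<Longrightarrow>
      (\<integral>\<^sup>+y\<in>A p. ennreal ((norm (y - p))\<^sup>2) \<partial>\<mu>) \<le> ennreal (e\<^sup>2) * emeasure \<mu> (A p)"
    and m: "\<And>p. p \<in> P \<Longrightarrow> 0 \<le> m p" "\<And>p. p \<in> P \<Longrightarrow> \<bar>m p - measure \<mu> (A p)\<bar> \<le> d * measure \<mu> (A p)" "0 \<le> d"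
    and g: "g \<in> borel_measurable borel" "\<And>x. 0 \<le> g x" "\<And>x. g x \<le> 1"
      "\<And>x x'. \<bar>g x - g x'\<bar> \<le> L * dist x x'" "0 \<le> L"
    and c: "1 \<le> c" and b: "1 \<le> b" "b * e\<^sup>2 \<le> B" and e: "0 < e"
  defines "R \<equiv> ennreal (exp B * (L + 1 + exp B) * (d + sqrt b * e))
      * (\<integral>\<^sup>+y. gauss_potential \<kappa> (b / (4 * c\<^sup>2)) (\<lambda>_. 1) y \<partial>\<mu>)"
  shows "(\<integral>\<^sup>+y. gauss_potential \<kappa> b g y \<partial>atomic_measure P m) \<le> (\<integral>\<^sup>+y. gauss_potential \<kappa> b g y \<partial>\<mu>) + R"
    and "(\<integral>\<^sup>+y. gauss_potential \<kappa> b g y \<partial>\<mu>) \<le> (\<integral>\<^sup>+y. gauss_potential \<kappa> b g y \<partial>atomic_measure P m) + R"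
proof -
  let ?H = "gauss_potential \<kappa> b g"
  let ?K = "ennreal (exp B * (L + 1 + exp B) * (d + sqrt b * e))"
  let ?I = "\<lambda>p. \<integral>\<^sup>+y\<in>A p. gauss_potential \<kappa> (b / (4 * c\<^sup>2)) (\<lambda>_. 1) y \<partial>\<mu>"
  have H: "?H \<in> borel_measurable borel"
    using \<kappa>(1,2) g(1) by (rule borel_measurable_gauss_potential)
  have 1: "gauss_potential \<kappa> (b / (4 * c\<^sup>2)) (\<lambda>_. 1) \<in> borel_measurable borel"
    using \<kappa>(1,2) by (rule borel_measurable_gauss_potential) simp
  have partition: "(\<integral>\<^sup>+y. f y \<partial>\<mu>) = (\<integral>\<^sup>+p. (\<integral>\<^sup>+y\<in>A p. f y \<partial>\<mu>) \<partial>count_space P)"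
    if "f \<in> borel_measurable borel" for f :: "'a \<Rightarrow> ennreal"
    using \<mu> P A(1,2,3) that by (rule nn_integral_countable_partition)
  have R: "R = (\<integral>\<^sup>+p. ?K * ?I p \<partial>count_space P)"
    unfolding R_def partition[OF 1] by (rule nn_integral_cmult[symmetric]) simp
  note cell = cell_error_le[OF \<mu> \<kappa> A(1) A(4) near var m(1,2) m(3) g c b e]
  have "(\<integral>\<^sup>+p. ennreal (m p) * ?H p \<partial>count_space P)
      \<le> (\<integral>\<^sup>+p. (\<integral>\<^sup>+y\<in>A p. ?H y \<partial>\<mu>) + ?K * ?I p \<partial>count_space P)"
    by (rule nn_integral_mono) (auto intro!: cell(1))
  also have "\<dots> = (\<integral>\<^sup>+y. ?H y \<partial>\<mu>) + R"
    unfolding R partition[OF H] by (rule nn_integral_add) auto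
  finally show "(\<integral>\<^sup>+y. ?H y \<partial>atomic_measure P m) \<le> (\<integral>\<^sup>+y. ?H y \<partial>\<mu>) + R"
    unfolding nn_integral_atomic_measure[OF H] .
  have "(\<integral>\<^sup>+y. ?H y \<partial>\<mu>) \<le> (\<integral>\<^sup>+p. ennreal (m p) * ?H p + ?K * ?I p \<partial>count_space P)"
    unfolding partition[OF H]
    by (rule nn_integral_mono) (auto intro!: cell(2))
  also have "\<dots> = (\<integral>\<^sup>+p. ennreal (m p) * ?H p \<partial>count_space P) + R"
    unfolding R by (rule nn_integral_add) auto
  finally show "(\<integral>\<^sup>+y. ?H y \<partial>\<mu>) \<le> (\<integral>\<^sup>+y. ?H y \<partial>atomic_measure P m) + R"
    unfolding nn_integral_atomic_measure[OF H] .
qed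

section \<open>Flat norm of a difference of finite measures\<close>

lemma BL_normD:
  assumes f: "bounded_lipschitz f" "BL_norm l f \<le> 1" and "l > 0"
  shows "\<bar>f x\<bar> \<le> 1" and "\<bar>f x - f y\<bar> \<le> dist x y / l"
proof -
  have "bdd_above (range (\<lambda>x. \<bar>f x\<bar>))"
    using f(1) unfolding bounded_lipschitz_def bounded_iff by (auto simp: bdd_above_def)
  then have "\<bar>f x\<bar> \<le> (SUP x. \<bar>f x\<bar>)"
    by (rule cSUP_upper2[OF _ UNIV_I order_refl])
  then show "\<bar>f x\<bar> \<le> 1"
    using f(2) unfolding BL_norm_def by simp
  let ?L = "{L. L-lipschitz_on UNIV f}"
  have ne: "?L \<noteq> {}"
    using f(1) unfolding bounded_lipschitz_def by auto
  have "\<bar>f x - f y\<bar> \<le> Inf ?L * dist x y"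
  proof (cases "x = y")
    case False
    then have "\<bar>f x - f y\<bar> / dist x y \<le> L" if "L \<in> ?L" for L
      using that lipschitz_onD[of L UNIV f x y] by (simp add: dist_real_def pos_divide_le_eq)
    then have "\<bar>f x - f y\<bar> / dist x y \<le> Inf ?L"
      using ne by (intro cInf_greatest)
    then show ?thesis
      using False by (simp add: pos_divide_le_eq)
  qed simp
  also have "Inf ?L \<le> 1 / l"
    using f(2) \<open>l > 0\<close> unfolding BL_norm_def by (simp add: pos_le_divide_eq mult.commute)
  finally show "\<bar>f x - f y\<bar> \<le> dist x y / l"
    by (simp add: mult_right_mono)
qed

lemma emeasure_le_TV_norm:
  fixes M :: "'a::topological_space measure"
  assumes "finite_measure M"
  shows "emeasure M UNIV \<le> TV_norm (measure M)"
proof -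
  interpret finite_measure M by fact
  let ?B = "\<lambda>i::nat. if i = 0 then UNIV :: 'a set else {}"
  have "emeasure M UNIV = (\<Sum>i. ennreal \<bar>measure M (?B i)\<bar>)"
    by (subst suminf_finite[of "{0}"]) (auto simp: emeasure_eq_measure)
  also have "\<dots> \<le> TV_norm (measure M)"
    unfolding TV_norm_def total_variation_def
    by (rule SUP_upper) (auto simp: disjoint_family_on_def)
  finally show ?thesis .
qed

text \<open>
  The positive and the negative part of an admissible function take values in \<open>{0..1}\<close> and inherit the
  Lipschitz constant, so a two-sided comparison on such functions suffices, at the price of a
  factor 2. Comparing the integrals of the constant 1 shows that \<open>M\<close> is finite.
\<close>

lemma flat_norm_diff_measure_le:
  fixes M N :: "'a::metric_space measure"
  assumes sets: "sets M = sets borel" "sets N = sets borel" and N: "finite_measure N" and l: "l > 0" and r: "0 \<le> r"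
    and MN: "\<And>g. g \<in> borel_measurable borel \<Longrightarrow> (\<And>x. 0 \<le> g x) \<Longrightarrow> (\<And>x. g x \<le> 1)
        \<Longrightarrow> (\<And>x x'. \<bar>g x - g x'\<bar> \<le> 1 / l * dist x x')
        \<Longrightarrow> (\<integral>\<^sup>+x. ennreal (g x) \<partial>M) \<le> (\<integral>\<^sup>+x. ennreal (g x) \<partial>N) + ennreal r"
    and NM: "\<And>g. g \<in> borel_measurable borel \<Longrightarrow> (\<And>x. 0 \<le> g x) \<Longrightarrow> (\<And>x. g x \<le> 1)
        \<Longrightarrow> (\<And>x x'. \<bar>g x - g x'\<bar> \<le> 1 / l * dist x x')
        \<Longrightarrow> (\<integral>\<^sup>+x. ennreal (g x) \<partial>N) \<le> (\<integral>\<^sup>+x. ennreal (g x) \<partial>M) + ennreal r"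
  shows "finite_measure M" and "flat_norm l (\<lambda>S. measure M S - measure N S) \<le> ennreal (2 * r)"
proof -
  interpret N: finite_measure N by fact
  have "(\<integral>\<^sup>+x. ennreal 1 \<partial>M) \<le> (\<integral>\<^sup>+x. ennreal 1 \<partial>N) + ennreal r"
    using l by (intro MN) auto
  also have "\<dots> < \<infinity>"
    by (simp add: less_top[symmetric])
  finally show M: "finite_measure M"
    by (intro finite_measureI) simp
  then interpret M: finite_measure M .
  have "signed_integral (\<lambda>S. measure M S - measure N S) f \<le> 2 * r"
    if f: "bounded_lipschitz f" "BL_norm l f \<le> 1" for f
  proof -
    note f1 = BL_normD(1)[OF f l] and f2 = BL_normD(2)[OF f l]
    obtain L where "L-lipschitz_on UNIV f"
      using f(1) unfolding bounded_lipschitz_def by blast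
    then have meas: "f \<in> borel_measurable borel"
      using borel_measurable_continuous_onI lipschitz_on_continuous_on by blast
    have split: "(\<integral>x. f x \<partial>K) = enn2real (\<integral>\<^sup>+x. ennreal (max 0 (f x)) \<partial>K) - enn2real (\<integral>\<^sup>+x. ennreal (max 0 (- f x)) \<partial>K)"
      "(\<integral>\<^sup>+x. ennreal (max 0 (f x)) \<partial>K) < \<infinity>" "(\<integral>\<^sup>+x. ennreal (max 0 (- f x)) \<partial>K) < \<infinity>"
      if "finite_measure K" "sets K = sets borel" for K
    proof -
      interpret K: finite_measure K by fact
      have int: "integrable K f"
        using f1 meas that(2) by (intro K.integrable_const_bound[of _ 1]) (auto simp: measurable_cong_sets[OF that(2) refl])
      have max: "ennreal (max 0 u) = ennreal u" for u
        by (simp add: max_def ennreal_neg)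
      show "(\<integral>x. f x \<partial>K) = enn2real (\<integral>\<^sup>+x. ennreal (max 0 (f x)) \<partial>K) - enn2real (\<integral>\<^sup>+x. ennreal (max 0 (- f x)) \<partial>K)"
        unfolding max using int by (rule real_lebesgue_integral_def)
      show "(\<integral>\<^sup>+x. ennreal (max 0 (f x)) \<partial>K) < \<infinity>" "(\<integral>\<^sup>+x. ennreal (max 0 (- f x)) \<partial>K) < \<infinity>"
        unfolding max using int by (auto simp: real_integrable_def less_top)
    qed
    have real_le: "enn2real u \<le> enn2real v + r" if "u \<le> v + ennreal r" "v < \<infinity>" for u v
    proof -
      have "enn2real u \<le> enn2real (v + ennreal r)"
        using that by (intro enn2real_mono) (auto simp: less_top)
      also have "\<dots> = enn2real v + r"
        using that r by (subst enn2real_plus) auto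
      finally show ?thesis .
    qed
    have "\<bar>max 0 u - max 0 v\<bar> \<le> \<bar>u - v\<bar>" for u v :: real
      by (auto simp: max_def)
    from order_trans[OF this] have lip: "\<bar>max 0 (f x) - max 0 (f x')\<bar> \<le> 1 / l * dist x x'"
      "\<bar>max 0 (- f x) - max 0 (- f x')\<bar> \<le> 1 / l * dist x x'" for x x'
      using f2[of x x'] by (simp_all add: abs_minus_commute)
    have range: "max 0 (f x) \<le> 1" "max 0 (- f x) \<le> 1" for x
      using f1[of x] by (auto simp: abs_le_iff)
    have "enn2real (\<integral>\<^sup>+x. ennreal (max 0 (f x)) \<partial>M) \<le> enn2real (\<integral>\<^sup>+x. ennreal (max 0 (f x)) \<partial>N) + r"
      using meas split[OF N sets(2)] lip range by (intro real_le MN) auto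
    moreover have "enn2real (\<integral>\<^sup>+x. ennreal (max 0 (- f x)) \<partial>N) \<le> enn2real (\<integral>\<^sup>+x. ennreal (max 0 (- f x)) \<partial>M) + r"
      using meas split[OF M sets(1)] lip range by (intro real_le NM) auto
    ultimately show ?thesis
      using f1 meas split(1)[OF M sets(1)] split(1)[OF N sets(2)]
      by (simp add: signed_integral_diff_measure[OF M N sets meas, of 1])
  qed
  then show "flat_norm l (\<lambda>S. measure M S - measure N S) \<le> ennreal (2 * r)"
    unfolding flat_norm_def by (intro SUP_least ennreal_leI) auto
qed

section \<open>Convergence rate of quantized thermalizations\<close>

theorem corollary4p2:
  fixes N :: nat
    and l :: real
    and E :: "'a::euclidean_space set"
    and \<mu>D \<mu>E :: "'a measure"
    and \<mu> :: "('a \<times> 'a) measure"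
    and \<beta>0 :: real
    and P :: "nat \<Rightarrow> 'a set"
    and m :: "nat \<Rightarrow> 'a \<Rightarrow> real"
    and \<mu>h :: "nat \<Rightarrow> ('a \<times> 'a) measure"
    and \<beta> \<epsilon> \<delta> :: "nat \<Rightarrow> real"
    and A :: "nat \<Rightarrow> 'a \<Rightarrow> 'a set"
  assumes dim_Z: "DIM('a) = 2 * N"
    and l_pos: "l > 0"
    and E: "affine E" "aff_dim E = int N"
    and \<mu>E: "\<mu>E = measure_restr (hausdorff_measure N) E"
    and \<mu>D: "radon_measure \<mu>D"
    and \<mu>: "\<mu> = \<mu>D \<Otimes>\<^sub>M \<mu>E" "radon_measure \<mu>"
    and \<beta>0_pos: "\<beta>0 > 0"
    and hyp1:
      "\<And>b. b \<ge> \<beta>0 \<Longrightarrow> finite_measure (thermalize b \<mu>)"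
      "uniformly_bounded ((\<lambda>b. measure (thermalize b \<mu>)) ` {\<beta>0..})"
      "uniformly_tight ((\<lambda>b. measure (thermalize b \<mu>)) ` {\<beta>0..})"
    and P_countable: "\<And>h. countable (P h)"
    and m_nonneg: "\<And>h p. p \<in> P h \<Longrightarrow> m h p \<ge> 0"
    and \<mu>h:
      "\<And>h. \<mu>h h = atomic_measure (P h) (m h) \<Otimes>\<^sub>M \<mu>E"
      "\<And>h. radon_measure (\<mu>h h)"
    and \<beta>_lim: "filterlim \<beta> at_top sequentially"
    and \<epsilon>_pos: "\<And>h. \<epsilon> h > 0"
    and \<epsilon>_lim: "\<epsilon> \<longlonglongrightarrow> 0"
    and A_partition:
      "\<And>h p. p \<in> P h \<Longrightarrow> A h p \<in> sets borel"
      "\<And>h. disjoint_family_on (A h) (P h)"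
      "\<And>h. (\<Union>p\<in>P h. A h p) = UNIV"
    and A_point: "\<And>h p. p \<in> P h \<Longrightarrow> p \<in> A h p"
    and A_finite: "\<And>h p. p \<in> P h \<Longrightarrow> emeasure \<mu>D (A h p) < \<infinity>"
    and hyp2: "\<exists>c>0. \<forall>h. \<forall>p\<in>P h. m h p \<le> c * measure \<mu>D (A h p)"
    and hyp3: "bounded (range (\<lambda>h. \<beta> h * (\<epsilon> h)\<^sup>2))"
    and hyp4: "\<exists>c\<ge>1. \<forall>h. \<forall>p\<in>P h. \<forall>z\<in>E. \<forall>y\<in>A h p.
                 (norm (p - z))\<^sup>2 \<le> c\<^sup>2 * ((\<epsilon> h)\<^sup>2 + (norm (y - z))\<^sup>2)"
    and hyp5: "\<And>h p. p \<in> P h \<Longrightarrow>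
                 (\<integral>\<^sup>+y\<in>A h p. ennreal ((norm (y - p))\<^sup>2) \<partial>\<mu>D) \<le> ennreal ((\<epsilon> h)\<^sup>2) * emeasure \<mu>D (A h p)"
    and \<delta>_nonneg: "\<And>h. \<delta> h \<ge> 0"
    and \<delta>_lim: "\<delta> \<longlonglongrightarrow> 0"
    and \<delta>: "\<And>h p. p \<in> P h \<Longrightarrow> \<bar>m h p - measure \<mu>D (A h p)\<bar> \<le> \<delta> h * measure \<mu>D (A h p)"
  shows "\<exists>C>0. \<forall>\<^sub>F h in sequentially.
           finite_measure (thermalize (\<beta> h) (\<mu>h h)) \<and>
           flat_norm l (\<lambda>S. measure (thermalize (\<beta> h) (\<mu>h h)) S - measure (thermalize (\<beta> h) \<mu>) S)
             \<le> ennreal (C * (\<delta> h + sqrt (\<beta> h) * \<epsilon> h)) *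
                (SUP b\<in>{\<beta>0..}. TV_norm (measure (thermalize b \<mu>)))"
proof -
  let ?S = "SUP b\<in>{\<beta>0..}. TV_norm (measure (thermalize b \<mu>))"
  obtain c where c: "1 \<le> c" and near: "\<And>h p z y. p \<in> P h \<Longrightarrow> z \<in> E \<Longrightarrow> y \<in> A h p
      \<Longrightarrow> (norm (p - z))\<^sup>2 \<le> c\<^sup>2 * ((\<epsilon> h)\<^sup>2 + (norm (y - z))\<^sup>2)"
    using hyp4 by blast
  obtain B where B: "\<And>h. \<beta> h * (\<epsilon> h)\<^sup>2 \<le> B"
    using hyp3 unfolding bounded_iff by (auto dest: abs_le_D1)
  define K where "K = exp B * (1 / l + 1 + exp B)"
  define C where "C = 2 * (K * (2 * c) ^ DIM('a))"
  have K: "0 < K"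
    unfolding K_def using l_pos by (intro mult_pos_pos add_pos_pos) auto
  have C: "0 < C"
    unfolding C_def using K c by simp
  have sets_\<mu>D: "sets \<mu>D = sets borel"
    using \<mu>D unfolding radon_measure_def by blast
  have sets_\<mu>E: "sets \<mu>E = sets borel"
    unfolding \<mu>E measure_restr_def by simp
  have sf: "sigma_finite_measure \<mu>E"
    unfolding \<mu>E using E by (rule sigma_finite_hausdorff_affine)
  have "E \<in> sets borel"
    using E(1) by (simp add: affine_closed)
  then have AE_E: "AE z in \<mu>E. z \<in> E"
    unfolding \<mu>E measure_restr_def by (subst AE_density) (auto simp: indicator_def split: if_splits)
  have S_fin: "?S < \<infinity>"
  proof -
    obtain C0 :: real where "\<And>b. b \<ge> \<beta>0 \<Longrightarrow> total_variation (measure (thermalize b \<mu>)) UNIV < ennreal C0"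
      using hyp1(2) unfolding uniformly_bounded_def by auto
    then have "?S \<le> ennreal C0"
      unfolding TV_norm_def by (intro SUP_least) (auto intro: less_imp_le)
    then show ?thesis
      by (rule order_le_less_trans) simp
  qed
  have "eventually (\<lambda>h. max 1 (4 * c\<^sup>2 * \<beta>0) \<le> \<beta> h) sequentially"
    using \<beta>_lim unfolding filterlim_at_top by blast
  then have "\<forall>\<^sub>F h in sequentially.
           finite_measure (thermalize (\<beta> h) (\<mu>h h)) \<and>
           flat_norm l (\<lambda>S. measure (thermalize (\<beta> h) (\<mu>h h)) S - measure (thermalize (\<beta> h) \<mu>) S)
             \<le> ennreal (C * (\<delta> h + sqrt (\<beta> h) * \<epsilon> h)) * ?S"
  proof (rule eventually_mono)
    fix h
    assume h: "max 1 (4 * c\<^sup>2 * \<beta>0) \<le> \<beta> h"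
    \<comment> \<open>The error will be measured at inverse temperature \<open>\<beta> h / (4 * c\<^sup>2)\<close>, which from here on is at least \<open>\<beta>0\<close>.\<close>
    let ?b = "\<beta> h" and ?b' = "\<beta> h / (4 * c\<^sup>2)"
    define q where "q = 1 / gauss_mass TYPE('a) ?b"
    define x where "x = \<delta> h + sqrt ?b * \<epsilon> h"
    define I where "I = (\<integral>\<^sup>+y. gauss_potential \<mu>E ?b' (\<lambda>_. 1) y \<partial>\<mu>D)"
    define r where "r = K * (2 * c) ^ DIM('a) * x * enn2real ?S"
    have b: "1 \<le> ?b"
      using h by simp
    have b': "\<beta>0 \<le> ?b'"
      using h c by (simp add: pos_le_divide_eq mult.commute)
    have c2: "1 \<le> c\<^sup>2"
      using c by simp
    have "?b' \<le> ?b / 1"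
      using b c2 by (intro divide_left_mono) auto
    then have b0: "\<beta>0 \<le> ?b"
      using b' by simp
    have x: "0 \<le> x"
      unfolding x_def using \<delta>_nonneg[of h] b less_imp_le[OF \<epsilon>_pos[of h]] by simp
    have r: "0 \<le> r"
      unfolding r_def using K c x by simp
    \<comment> \<open>\<open>?b' = (1 / (2 * c))\<^sup>2 * ?b\<close>\<close>
    have scale: "q = (2 * c) ^ DIM('a) * (1 / gauss_mass TYPE('a) ?b')"
      using gauss_mass_scale[where 'a = 'a, of "1 / (2 * c)" ?b] c
      unfolding q_def by (simp add: power_divide power_mult_distrib)
    \<comment> \<open>Up to normalisation, \<open>I\<close> is the total mass of the thermalized measure at \<open>?b'\<close>.\<close>
    have R: "ennreal q * (ennreal (K * x) * I) \<le> ennreal r"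
    proof -
      interpret T: finite_measure "thermalize ?b' \<mu>"
        using hyp1(1)[OF b'] .
      have "ennreal (1 / gauss_mass TYPE('a) ?b') * I = (\<integral>\<^sup>+x. ennreal 1 \<partial>thermalize ?b' (\<mu>D \<Otimes>\<^sub>M \<mu>E))"
        unfolding I_def by (subst nn_integral_thermalize_pair[OF sets_\<mu>D sf sets_\<mu>E]) auto
      also have "\<dots> = emeasure (thermalize ?b' \<mu>) UNIV"
        unfolding \<mu>(1)[symmetric]
        using sets_eq_imp_space_eq[OF sets_thermalize_pair[OF sets_\<mu>D sets_\<mu>E, of ?b']] by (simp add: \<mu>(1))
      also have "\<dots> \<le> TV_norm (measure (thermalize ?b' \<mu>))"
        by (rule emeasure_le_TV_norm) (rule hyp1(1)[OF b'])
      also have "\<dots> \<le> ?S"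
        using b' by (intro SUP_upper) simp
      finally have I: "ennreal (1 / gauss_mass TYPE('a) ?b') * I \<le> ?S" .
      have "ennreal q * (ennreal (K * x) * I)
          = ennreal (K * (2 * c) ^ DIM('a) * x) * (ennreal (1 / gauss_mass TYPE('a) ?b') * I)"
      proof -
        have "ennreal q * ennreal (K * x) = ennreal (K * (2 * c) ^ DIM('a) * x) * ennreal (1 / gauss_mass TYPE('a) ?b')"
          unfolding scale using K c x gauss_mass_nonneg[where 'a = 'a, of ?b']
          by (subst (1 2) ennreal_mult[symmetric]) (auto simp: ac_simps)
        then show ?thesis
          by (simp only: mult.assoc[symmetric])
      qed
      also have "\<dots> \<le> ennreal (K * (2 * c) ^ DIM('a) * x) * ?S"
        using I by (rule mult_left_mono) simp
      also have "\<dots> = ennreal r"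
        unfolding r_def using K c x S_fin by (simp add: ennreal_mult less_top)
      finally show ?thesis .
    qed
    note atomic = sets_atomic_measure[of "P h" "m h"]
    have "finite_measure (thermalize ?b (\<mu>h h))"
      and flat: "flat_norm l (\<lambda>S. measure (thermalize ?b (\<mu>h h)) S - measure (thermalize ?b \<mu>) S) \<le> ennreal (2 * r)"
    proof -
      have comparison: "(\<integral>\<^sup>+x. ennreal (g x) \<partial>thermalize ?b (\<mu>h h)) \<le> (\<integral>\<^sup>+x. ennreal (g x) \<partial>thermalize ?b \<mu>) + ennreal r"
        "(\<integral>\<^sup>+x. ennreal (g x) \<partial>thermalize ?b \<mu>) \<le> (\<integral>\<^sup>+x. ennreal (g x) \<partial>thermalize ?b (\<mu>h h)) + ennreal r"
        if g: "g \<in> borel_measurable borel" "\<And>x. 0 \<le> g x" "\<And>x. g x \<le> 1"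
          "\<And>x x'. \<bar>g x - g x'\<bar> \<le> 1 / l * dist x x'" for g :: "'a \<times> 'a \<Rightarrow> real"
      proof -
        have L: "0 \<le> 1 / l"
          using l_pos by simp
        have up: "(\<integral>\<^sup>+y. gauss_potential \<mu>E ?b g y \<partial>atomic_measure (P h) (m h))
            \<le> (\<integral>\<^sup>+y. gauss_potential \<mu>E ?b g y \<partial>\<mu>D) + ennreal (K * x) * I"
          unfolding K_def x_def I_def
          by (rule quantization_error_le(1)[where E = E and A = "A h" and c = c]; (assumption
              | rule sets_\<mu>D sf sets_\<mu>E AE_E P_countable A_partition A_finite near hyp5 m_nonneg \<delta> \<delta>_nonneg
                  g L c b B \<epsilon>_pos)+)
        have down: "(\<integral>\<^sup>+y. gauss_potential \<mu>E ?b g y \<partial>\<mu>D)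
            \<le> (\<integral>\<^sup>+y. gauss_potential \<mu>E ?b g y \<partial>atomic_measure (P h) (m h)) + ennreal (K * x) * I"
          unfolding K_def x_def I_def
          by (rule quantization_error_le(2)[where E = E and A = "A h" and c = c]; (assumption
              | rule sets_\<mu>D sf sets_\<mu>E AE_E P_countable A_partition A_finite near hyp5 m_nonneg \<delta> \<delta>_nonneg
                  g L c b B \<epsilon>_pos)+)
        have mult: "ennreal q * u \<le> ennreal q * v + ennreal r" if "u \<le> v + ennreal (K * x) * I" for u v
        proof -
          have "ennreal q * u \<le> ennreal q * v + ennreal q * (ennreal (K * x) * I)"
            using mult_left_mono[OF that, of "ennreal q"] by (simp add: distrib_left)
          then show ?thesis
            using R by (meson add_left_mono order_trans)
        qed
        show "(\<integral>\<^sup>+x. ennreal (g x) \<partial>thermalize ?b (\<mu>h h)) \<le> (\<integral>\<^sup>+x. ennreal (g x) \<partial>thermalize ?b \<mu>) + ennreal r"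
          "(\<integral>\<^sup>+x. ennreal (g x) \<partial>thermalize ?b \<mu>) \<le> (\<integral>\<^sup>+x. ennreal (g x) \<partial>thermalize ?b (\<mu>h h)) + ennreal r"
          unfolding \<mu>(1) \<mu>h(1) nn_integral_thermalize_pair[OF atomic sf sets_\<mu>E g(1,2)]
            nn_integral_thermalize_pair[OF sets_\<mu>D sf sets_\<mu>E g(1,2)] q_def[symmetric]
          using up down by (auto intro!: mult)
      qed
      have sets: "sets (thermalize ?b (\<mu>h h)) = sets borel" "sets (thermalize ?b \<mu>) = sets borel"
        unfolding \<mu>(1) \<mu>h(1) using atomic sets_\<mu>D sets_\<mu>E by (simp_all add: sets_thermalize_pair)
      show "finite_measure (thermalize ?b (\<mu>h h))"
        "flat_norm l (\<lambda>S. measure (thermalize ?b (\<mu>h h)) S - measure (thermalize ?b \<mu>) S) \<le> ennreal (2 * r)"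
        by (rule flat_norm_diff_measure_le[OF sets hyp1(1)[OF b0] l_pos r], (rule comparison; assumption)+)+
    qed
    moreover have "ennreal (2 * r) = ennreal (C * (\<delta> h + sqrt (\<beta> h) * \<epsilon> h)) * ?S"
    proof -
      have "2 * r = C * x * enn2real ?S"
        unfolding r_def C_def by simp
      then have "ennreal (2 * r) = ennreal (C * x) * ennreal (enn2real ?S)"
        using C x by (simp add: ennreal_mult)
      then show ?thesis
        unfolding x_def using S_fin by (simp add: less_top)
    qed
    ultimately show "finite_measure (thermalize (\<beta> h) (\<mu>h h)) \<and>
           flat_norm l (\<lambda>S. measure (thermalize (\<beta> h) (\<mu>h h)) S - measure (thermalize (\<beta> h) \<mu>) S)
             \<le> ennreal (C * (\<delta> h + sqrt (\<beta> h) * \<epsilon> h)) * ?S"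
      by simp
  qed
  with C show ?thesis
    by blast
qed

end
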